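(* Let $p$ be a prime and $n$ a positive integer with $p \nmid n$. Let $f : \mathbb{F}_p^\times \to \mathbb{C}^\times$ be a function every value of which is an $n$-th root of unity, and suppose $f(1) = 1$. Then $f$ is a nontrivial character of $\mathbb{F}_p^\times$ if and only if there exists $a \in \mathbb{F}_p^\times$ such that $|\widehat{f}(a)| = 1$.
   Context: For $\alpha \in \mathbb{R}$ write $e(\alpha) := e^{2\pi i \alpha}$. A function $f : \mathbb{F}_p^\times \to \mathbb{C}$ is extended to $\mathbb{F}_p$ by setting $f(0) := 0$, and its Fourier transform $\widehat{f} : \mathbb{F}_p \to \mathbb{C}$ is defined by $\widehat{f}(\xi) := \frac{1}{\sqrt{p}} \sum_{x \in \mathbb{F}_p} f(x)\, e(-x\xi/p)$. A character of $\mathbb{F}_p^\times$ is a group homomorphism $\mathbb{F}_p^\times \to \mathbb{C}^\times$; it is nontrivial if it is not identically $1$. *)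

theory Defs
  imports Complex_Main "HOL-Number_Theory.Residues"
begin

text \<open>
  The field with p elements is \<^term>\<open>residue_ring (int p)\<close>, with carrier
  \<^term>\<open>{0..int p - 1}\<close>; its elements are thus identified with their least nonnegative
  integer representatives.
\<close>

abbreviation Fp_units :: "nat \<Rightarrow> int monoid" where
  "Fp_units p \<equiv> units_of (residue_ring (int p))"

definition complex_units :: "complex monoid" where
  "complex_units = \<lparr>carrier = UNIV - {0}, monoid.mult = (*), one = 1\<rparr>"

definition additive_exp :: "real \<Rightarrow> complex" where
  "additive_exp \<alpha> = exp (2 * of_real pi * \<i> * of_real \<alpha>)"

definition extend_by_zero :: "nat \<Rightarrow> (int \<Rightarrow> complex) \<Rightarrow> int \<Rightarrow> complex" where
  "extend_by_zero p f x = (if x \<in> carrier (Fp_units p) then f x else 0)"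

text \<open>
  The value of the additive exponential below depends only on the product of \<open>x\<close> and \<open>\<xi>\<close>
  modulo p, so taking this product in the integers is harmless.
\<close>

definition fourier :: "nat \<Rightarrow> (int \<Rightarrow> complex) \<Rightarrow> int \<Rightarrow> complex" where
  "fourier p f \<xi> =
    1 / of_real (sqrt (real p)) *
    (\<Sum>x\<in>carrier (residue_ring (int p)).
       extend_by_zero p f x * additive_exp (- (real_of_int x * real_of_int \<xi>) / real p))"

definition mult_character :: "nat \<Rightarrow> (int \<Rightarrow> complex) \<Rightarrow> bool" where
  "mult_character p f \<longleftrightarrow> f \<in> hom (Fp_units p) complex_units"

definition nontrivial_mult_character :: "nat \<Rightarrow> (int \<Rightarrow> complex) \<Rightarrow> bool" where
  "nontrivial_mult_character p f \<longleftrightarrow>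
     mult_character p f \<and> \<not> (\<forall>x\<in>carrier (Fp_units p). f x = 1)"

end

theory Submission
  imports Defs "Jordan_Normal_Form.Char_Poly"
begin

text \<open>
  If \<open>f\<close> is a nontrivial character, \<open>\<bar>G\<bar>\<^sup>2 = p\<close> for its Gauss sum \<open>G\<close> is the classical
  computation. For the converse, let \<open>G = \<Sum>x. f x * z\<^sup>x\<close> be the sum with \<open>\<bar>G\<bar>\<^sup>2 = p\<close>, and let
  \<open>I\<close> be a maximal ideal over \<open>p\<close> in the ring generated by the roots of unity of order \<open>n p\<close>.
  Since \<open>p\<close> does not divide \<open>n\<close>, it is unramified in \<open>\<int>[e(1/n)]\<close>, so that in the expansion
  \<open>G = \<Sum>j. (z - 1)\<^sup>j * (\<Sum>x. f x * (x choose j))\<close> the coefficients that lie in \<open>I\<close> are locally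
  divisible by \<open>p\<close>, that is, by \<open>(z - 1)\<^bsup>p-1\<^esup>\<close>. Hence the order of \<open>G\<close> at \<open>z - 1\<close>, capped at
  \<open>p - 1\<close>, is the number \<open>k\<close> of leading coefficients in \<open>I\<close>, and the corresponding numbers \<open>k\<close>, \<open>l\<close> for \<open>G\<close> and its
  conjugate satisfy \<open>k + l \<ge> p - 1\<close>, because their product is \<open>p\<close>. Modulo \<open>I\<close>, vanishing of the first
  \<open>k\<close> moments says that \<open>f\<close> is a polynomial of degree at most \<open>p - 1 - k\<close>, and likewise \<open>1 / f\<close> has
  degree at most \<open>p - 1 - l\<close>. Their product therefore equals \<open>x\<^bsup>p-1\<^esup>\<close> as a polynomial, so \<open>f\<close> is a
  monomial modulo \<open>I\<close>. Distinct \<open>n\<close>-th roots of unity stay distinct modulo \<open>I\<close>, hence \<open>f\<close> is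
  multiplicative.
\<close>

section \<open>Subrings generated by roots of unity\<close>

text \<open>Subrings are sets inside one ambient type, so that \<open>int_adjoin w\<close> and
  \<open>int_adjoin \<theta>\<close> can be compared inside the complex numbers.\<close>

locale unital_subring =
  fixes S :: "'a::comm_ring_1 set"
  assumes one_mem [simp]: "1 \<in> S"
    and diff_mem [intro]: "x \<in> S \<Longrightarrow> y \<in> S \<Longrightarrow> x - y \<in> S"
    and mult_mem [intro]: "x \<in> S \<Longrightarrow> y \<in> S \<Longrightarrow> x * y \<in> S"
begin

lemma zero_mem [simp]: "0 \<in> S"
  using diff_mem[of 1 1] by simp

lemma uminus_mem [intro]: "x \<in> S \<Longrightarrow> - x \<in> S"
  using diff_mem[of 0 x] by simp

lemma add_mem [intro]: "x \<in> S \<Longrightarrow> y \<in> S \<Longrightarrow> x + y \<in> S"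
  using diff_mem[of x "- y"] by auto

lemma power_mem [intro]: "x \<in> S \<Longrightarrow> x ^ k \<in> S"
  by (induction k) auto

lemma of_nat_mem [simp]: "of_nat k \<in> S"
  by (induction k) auto

lemma of_int_mem [simp]: "of_int k \<in> S"
  by (cases k) (auto simp del: of_nat_Suc)

lemma sum_mem: "(\<And>x. x \<in> A \<Longrightarrow> h x \<in> S) \<Longrightarrow> sum h A \<in> S"
  by (induction A rule: infinite_finite_induct) auto

text \<open>The middle binomial coefficients are multiples of \<open>p\<close>. The error term is
  exhibited inside \<open>S\<close>, since divisibility by \<open>p\<close> is meant in
  \<open>S\<close>.\<close>

lemma frobenius_add:
  assumes "prime p" "a \<in> S" "b \<in> S"
  shows "\<exists>c\<in>S. (a + b) ^ p = a ^ p + b ^ p + of_nat p * c"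
proof -
  have p2: "p \<ge> 2" using assms(1) by (rule prime_ge_2_nat)
  let ?t = "\<lambda>k. of_nat (p choose k) * a ^ k * b ^ (p - k)"
  let ?c = "\<lambda>k. of_nat ((p choose k) div p) * a ^ k * b ^ (p - k)"
  have eq: "?t k = of_nat p * ?c k" if "k \<in> {1..<p}" for k
  proof -
    have "p dvd p choose k"
      using that assms(1) by (intro dvd_choose_prime) auto
    then have "p choose k = p * ((p choose k) div p)" by simp
    then have "of_nat (p choose k) = (of_nat p * of_nat ((p choose k) div p) :: 'a)"
      by (metis of_nat_mult)
    then show ?thesis by (simp add: mult.assoc)
  qed
  have set: "{..p} = insert 0 (insert p {1..<p})" using p2 by auto
  have "(a + b) ^ p = (\<Sum>k\<le>p. ?t k)" by (rule binomial_ring)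
  also have "\<dots> = b ^ p + a ^ p + (\<Sum>k\<in>{1..<p}. ?t k)"
    unfolding set using p2 by simp
  also have "(\<Sum>k\<in>{1..<p}. ?t k) = of_nat p * (\<Sum>k\<in>{1..<p}. ?c k)"
    unfolding sum_distrib_left by (intro sum.cong eq) auto
  finally have "(a + b) ^ p = a ^ p + b ^ p + of_nat p * (\<Sum>k\<in>{1..<p}. ?c k)"
    by simp
  moreover have "(\<Sum>k\<in>{1..<p}. ?c k) \<in> S"
    using assms by (intro sum_mem mult_mem power_mem of_nat_mem)
  ultimately show ?thesis by blast
qed

lemma frobenius_power_add:
  assumes "prime p" "a \<in> S" "b \<in> S"
  shows "\<exists>c\<in>S. (a + b) ^ (p ^ m) = a ^ (p ^ m) + b ^ (p ^ m) + of_nat p * c"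
proof (induction m)
  case 0
  show ?case by (intro bexI[of _ 0]) auto
next
  case (Suc m)
  obtain c where c: "c \<in> S" "(a + b) ^ (p ^ m) = a ^ (p ^ m) + b ^ (p ^ m) + of_nat p * c"
    using Suc.IH by auto
  let ?u = "a ^ (p ^ m)" and ?v = "b ^ (p ^ m)"
  have uv: "?u \<in> S" "?v \<in> S" using assms by auto
  obtain d where d: "d \<in> S" "(?u + ?v) ^ p = ?u ^ p + ?v ^ p + of_nat p * d"
    using frobenius_add[OF assms(1) uv] by auto
  \<comment> \<open>The accumulated error \<open>p * c\<close> is split off by one more Frobenius
    step; its \<open>p\<close>-th power is again a multiple of \<open>p\<close>.\<close>
  obtain e where e: "e \<in> S"
    "(?u + ?v + of_nat p * c) ^ p = (?u + ?v) ^ p + (of_nat p * c) ^ p + of_nat p * e"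
    using frobenius_add[OF assms(1) add_mem[OF uv] mult_mem[OF of_nat_mem c(1)]] by auto
  obtain p' where p': "p = Suc p'" using assms(1) not0_implies_Suc prime_gt_0_nat by blast
  have pc: "(of_nat p * c) ^ p = of_nat p * (c * (of_nat p * c) ^ p')"
    unfolding p' by (simp del: of_nat_Suc add: mult.assoc)
  have pw: "x ^ p ^ Suc m = (x ^ p ^ m) ^ p" for x :: 'a
    by (simp add: power_mult[symmetric] mult.commute)
  have "(a + b) ^ p ^ Suc m = a ^ p ^ Suc m + b ^ p ^ Suc m
     + of_nat p * (d + c * (of_nat p * c) ^ p' + e)"
    unfolding pw c(2) e(2) d(2) pc by (simp add: algebra_simps)
  moreover have "d + c * (of_nat p * c) ^ p' + e \<in> S"
    using c(1) d(1) e(1) by (intro add_mem mult_mem power_mem of_nat_mem)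
  ultimately show ?case by blast
qed

end

section \<open>Rings generated over the integers by one complex number\<close>

definition int_adjoin :: "complex \<Rightarrow> complex set" where
  "int_adjoin z = range (\<lambda>q. poly (map_poly of_int q) z)"

lemma unital_subring_int_adjoin: "unital_subring (int_adjoin z)"
proof
  show "1 \<in> int_adjoin z"
    unfolding int_adjoin_def by (rule range_eqI[of _ _ 1]) simp
next
  fix x y assume "x \<in> int_adjoin z" "y \<in> int_adjoin z"
  then obtain q r where qr: "x = poly (map_poly of_int q) z" "y = poly (map_poly of_int r) z"
    unfolding int_adjoin_def by auto
  have "x - y = poly (map_poly of_int (q - r)) z" "x * y = poly (map_poly of_int (q * r)) z"
    unfolding qr by (simp_all add: hom_distribs)
  then show "x - y \<in> int_adjoin z" "x * y \<in> int_adjoin z"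
    unfolding int_adjoin_def by blast+
qed

lemma generator_mem_int_adjoin: "z \<in> int_adjoin z"
  unfolding int_adjoin_def by (rule range_eqI[of _ _ "[:0, 1:]"]) simp

text \<open>Minimality serves as an induction principle: a property holds on all of
  \<open>int_adjoin z\<close> once the elements having it form a subring containing
  \<open>z\<close>.\<close>

lemma int_adjoin_subset:
  assumes "unital_subring T" "z \<in> T"
  shows "int_adjoin z \<subseteq> T"
proof -
  interpret unital_subring T by fact
  have "poly (map_poly of_int q) z \<in> T" for q
    by (induction q rule: pCons_induct) (use assms(2) in \<open>auto simp: map_poly_pCons\<close>)
  then show ?thesis by (auto simp: int_adjoin_def)
qed

lemma root_of_unity_mem_int_adjoin:
  assumes "N > 0" "w ^ N = 1"
  shows "w \<in> int_adjoin (cis (2 * pi / real N))"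
proof -
  interpret unital_subring "int_adjoin (cis (2 * pi / real N))"
    by (rule unital_subring_int_adjoin)
  obtain k where "w = cis (2 * pi * real k / real N)"
    using bij_betw_roots_unity[OF assms(1)] assms(2) unfolding bij_betw_def by blast
  then have "w = cis (2 * pi / real N) ^ k"
    by (simp add: DeMoivre mult_ac)
  then show ?thesis using generator_mem_int_adjoin by auto
qed

text \<open>Multiplication by an element of \<open>\<int>[z]\<close> has \<open>(1, z, \<dots>, z\<^bsup>N-1\<^esup>)\<close> as an eigenvector of an
  integer matrix.\<close>

lemma int_adjoin_root_of_unity_algebraic_int:
  assumes "N > 0" "z ^ N = 1" "s \<in> int_adjoin z"
  shows "algebraic_int s"
proof -
  obtain q where q: "s = poly (map_poly of_int q) z"
    using assms(3) by (auto simp: int_adjoin_def)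
  \<comment> \<open>Row \<open>i\<close> holds the coefficients of \<open>s * z ^ i\<close> after
    exponents are reduced modulo \<open>N\<close>.\<close>
  define A where "A = mat N N (\<lambda>(i, j). \<Sum>m\<le>degree q. if (m + i) mod N = j then coeff q m else 0)"
  define v where "v = vec N (\<lambda>j. z ^ j)"
  have A: "A \<in> carrier_mat N N" by (simp add: A_def)
  let ?B = "map_mat of_int A :: complex mat"
  have B: "?B \<in> carrier_mat N N" using A by simp
  have zmod: "z ^ (m mod N) = z ^ m" for m
  proof -
    have "z ^ m = z ^ (N * (m div N) + m mod N)" by simp
    also have "\<dots> = z ^ (m mod N)" by (simp only: power_add power_mult assms(2)) simp
    finally show ?thesis by simp
  qed
  have s: "s = (\<Sum>m\<le>degree q. of_int (coeff q m) * z ^ m)"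
    unfolding q by (simp add: poly_altdef)
  have "?B *\<^sub>v v = s \<cdot>\<^sub>v v"
  proof (rule eq_vecI)
    fix i assume "i < dim_vec (s \<cdot>\<^sub>v v)"
    then have i: "i < N" by (simp add: v_def)
    have "(?B *\<^sub>v v) $ i = (\<Sum>j<N. of_int (A $$ (i, j)) * z ^ j)"
      using i A by (simp add: scalar_prod_def v_def lessThan_atLeast0)
    also have "\<dots> = (\<Sum>j<N. \<Sum>m\<le>degree q. if (m + i) mod N = j then of_int (coeff q m) * z ^ j else 0)"
      using i by (intro sum.cong refl) (auto simp: A_def sum_distrib_right intro!: sum.cong)
    also have "\<dots> = (\<Sum>m\<le>degree q. \<Sum>j<N. if (m + i) mod N = j then of_int (coeff q m) * z ^ j else 0)"
      by (rule sum.swap)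
    also have "\<dots> = (\<Sum>m\<le>degree q. of_int (coeff q m) * z ^ ((m + i) mod N))"
      using assms(1) by (intro sum.cong refl) (simp add: sum.delta)
    also have "\<dots> = s * z ^ i"
      unfolding zmod s by (simp add: power_add sum_distrib_right mult.assoc)
    finally show "(?B *\<^sub>v v) $ i = (s \<cdot>\<^sub>v v) $ i"
      using i by (simp add: v_def)
  qed (use A in \<open>simp add: v_def\<close>)
  moreover have "v \<noteq> 0\<^sub>v N"
  proof
    assume "v = 0\<^sub>v N"
    then have "v $ 0 = 0\<^sub>v N $ 0" by simp
    then show False using assms(1) by (simp add: v_def)
  qed
  ultimately have "eigenvector ?B v s"
    unfolding eigenvector_def using A by (simp add: v_def)
  then have "eigenvalue ?B s" unfolding eigenvalue_def by blast
  then have "poly (char_poly ?B) s = 0"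
    using eigenvalue_root_char_poly[OF B] by simp
  also have "char_poly ?B = map_poly of_int (char_poly A)"
    by (rule of_int_hom.char_poly_hom[OF A])
  finally have "poly (map_poly of_int (char_poly A)) s = 0" .
  moreover have "lead_coeff (char_poly A) = 1"
    using degree_monic_char_poly[OF A] by simp
  ultimately show ?thesis unfolding algebraic_int_altdef_ipoly by blast
qed

text \<open>Modulo \<open>p\<close>, raising to the power \<open>p ^ totient n\<close> is a ring
  homomorphism, and by Euler's theorem it fixes \<open>w\<close>; its fixed elements form a subring,
  hence are everything. In this form \<open>p\<close> being unramified in
  \<open>int_adjoin w\<close> enters.\<close>

lemma int_adjoin_power_eq_self:
  assumes p: "prime p" "coprime p n" and w: "w ^ n = 1" and a: "a \<in> int_adjoin w"
  shows "\<exists>c\<in>int_adjoin w. a ^ (p ^ totient n) = a + of_nat p * c"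
proof -
  let ?R = "int_adjoin w" and ?Q = "p ^ totient n"
  interpret unital_subring ?R by (rule unital_subring_int_adjoin)
  let ?T = "{a \<in> ?R. \<exists>c\<in>?R. a ^ ?Q = a + of_nat p * c}"
  have "unital_subring ?T"
  proof
    have "1 ^ ?Q = 1 + of_nat p * (0 :: complex)" by simp
    then show "1 \<in> ?T" using one_mem zero_mem by blast
  next
    fix x y assume "x \<in> ?T" "y \<in> ?T"
    then obtain c d where x: "x \<in> ?R" "c \<in> ?R" "x ^ ?Q = x + of_nat p * c"
      and y: "y \<in> ?R" "d \<in> ?R" "y ^ ?Q = y + of_nat p * d" by blast
    \<comment> \<open>Additivity is applied to \<open>x - y + y\<close>, which avoids the sign of a
      power of \<open>- 1\<close>.\<close>
    obtain e where e: "e \<in> ?R" "(x - y + y) ^ ?Q = (x - y) ^ ?Q + y ^ ?Q + of_nat p * e"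
      using frobenius_power_add[OF p(1) diff_mem[OF x(1) y(1)] y(1)] by auto
    have "(x - y) ^ ?Q = (x - y) + of_nat p * (c - d - e)"
      using e(2) x(3) y(3) by (simp add: algebra_simps)
    moreover have "c - d - e \<in> ?R" using x y e by auto
    ultimately show "x - y \<in> ?T" using x y by blast
    have "(x * y) ^ ?Q = x * y + of_nat p * (x * d + c * y + of_nat p * c * d)"
      unfolding power_mult_distrib x(3) y(3) by (simp add: algebra_simps)
    moreover have "x * d + c * y + of_nat p * c * d \<in> ?R"
      using x(1,2) y(1,2) by (intro add_mem mult_mem of_nat_mem)
    ultimately show "x * y \<in> ?T" using x y by blast
  qed
  moreover have "w \<in> ?T"
  proof -
    have "[?Q = 1] (mod n)" by (rule euler_theorem) fact
    moreover have "?Q \<ge> 1" using p(1) by (simp add: prime_gt_0_nat Suc_leI)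
    ultimately have "n dvd ?Q - 1" by (simp add: cong_altdef_nat cong_sym)
    then obtain k where "?Q - 1 = n * k" ..
    with \<open>?Q \<ge> 1\<close> have "?Q = n * k + 1" by simp
    then have "w ^ ?Q = w" by (simp add: power_add power_mult w)
    then have "w ^ ?Q = w + of_nat p * 0" by simp
    then show ?thesis using zero_mem generator_mem_int_adjoin by blast
  qed
  ultimately have "?R \<subseteq> ?T" by (rule int_adjoin_subset)
  with a show ?thesis by blast
qed

section \<open>Prime ideals over \<open>p\<close>\<close>

locale prime_ideal_over = unital_subring S for S :: "'a::idom set" +
  fixes I :: "'a set" and p :: nat
  assumes prime_p: "prime p"
    and p_mem: "of_nat p \<in> I"
    and ideal_subset: "x \<in> I \<Longrightarrow> x \<in> S"
    and ideal_diff: "x \<in> I \<Longrightarrow> y \<in> I \<Longrightarrow> x - y \<in> I"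
    and ideal_mult: "x \<in> S \<Longrightarrow> y \<in> I \<Longrightarrow> x * y \<in> I"
    and one_notin: "1 \<notin> I"
    and prime_ideal: "x \<in> S \<Longrightarrow> y \<in> S \<Longrightarrow> x * y \<in> I \<Longrightarrow> x \<in> I \<or> y \<in> I"

text \<open>Zorn's lemma gives a maximal proper ideal containing \<open>p\<close>, and maximal
  ideals are prime. That \<open>p\<close> is not a unit makes the ideal of its multiples proper, so
  the family is nonempty.\<close>

lemma ex_prime_ideal_over:
  fixes S :: "'a::idom set"
  assumes "unital_subring S" and p: "prime p" and unit: "\<And>s. s \<in> S \<Longrightarrow> of_nat p * s \<noteq> 1"
  shows "\<exists>I. prime_ideal_over S I p"
proof -
  interpret unital_subring S by fact
  define \<A> where "\<A> = {I. I \<subseteq> S \<and> of_nat p \<in> I \<and> 1 \<notin> I \<and> (\<forall>x\<in>I. \<forall>y\<in>I. x - y \<in> I)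
    \<and> (\<forall>x\<in>S. \<forall>y\<in>I. x * y \<in> I)}"
  have "(\<lambda>s. of_nat p * s) ` S \<in> \<A>"
  proof -
    have "of_nat p \<in> (\<lambda>s. of_nat p * s) ` S"
      by (rule image_eqI[of _ _ 1]) auto
    moreover have "1 \<notin> (\<lambda>s. of_nat p * s) ` S" using unit by auto
    moreover have "of_nat p * x - of_nat p * y \<in> (\<lambda>s. of_nat p * s) ` S" if "x \<in> S" "y \<in> S" for x y
      by (rule image_eqI[of _ _ "x - y"]) (use that in \<open>auto simp: algebra_simps\<close>)
    moreover have "x * (of_nat p * y) \<in> (\<lambda>s. of_nat p * s) ` S" if "x \<in> S" "y \<in> S" for x y
      by (rule image_eqI[of _ _ "x * y"]) (use that in \<open>auto simp: algebra_simps\<close>)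
    ultimately show ?thesis unfolding \<A>_def by auto
  qed
  then have "\<A> \<noteq> {}" by blast
  moreover have "\<Union>\<C> \<in> \<A>" if "\<C> \<noteq> {}" "subset.chain \<A> \<C>" for \<C>
  proof -
    have sub: "\<C> \<subseteq> \<A>" using that(2) by (simp add: subset.chain_def)
    have "x - y \<in> \<Union>\<C>" if xy: "x \<in> \<Union>\<C>" "y \<in> \<Union>\<C>" for x y
    proof -
      obtain J K where JK: "J \<in> \<C>" "x \<in> J" "K \<in> \<C>" "y \<in> K" using xy by blast
      then have "J \<subseteq> K \<or> K \<subseteq> J" using \<open>subset.chain \<A> \<C>\<close> by (auto simp: subset_chain_def)
      then obtain L where "L \<in> \<C>" "x \<in> L" "y \<in> L" using JK by blast
      then have "x - y \<in> L" using sub unfolding \<A>_def by blast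
      then show ?thesis using \<open>L \<in> \<C>\<close> by blast
    qed
    moreover have "\<Union>\<C> \<subseteq> S" "of_nat p \<in> \<Union>\<C>" "1 \<notin> \<Union>\<C>" "\<forall>x\<in>S. \<forall>y\<in>\<Union>\<C>. x * y \<in> \<Union>\<C>"
      using sub that(1) unfolding \<A>_def by blast+
    ultimately show ?thesis unfolding \<A>_def by blast
  qed
  ultimately obtain I where I: "I \<in> \<A>" and max: "\<And>J. J \<in> \<A> \<Longrightarrow> I \<subseteq> J \<Longrightarrow> J = I"
    using subset_Zorn_nonempty[of \<A>] by metis
  have I': "I \<subseteq> S" "of_nat p \<in> I" "1 \<notin> I" "\<And>x y. x \<in> I \<Longrightarrow> y \<in> I \<Longrightarrow> x - y \<in> I"
    "\<And>x y. x \<in> S \<Longrightarrow> y \<in> I \<Longrightarrow> x * y \<in> I"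
    using I unfolding \<A>_def by blast+
  have zero: "0 \<in> I" using I'(4)[OF I'(2) I'(2)] by simp
  have add: "x + y \<in> I" if "x \<in> I" "y \<in> I" for x y
    using I'(4)[OF that(1) I'(4)[OF zero that(2)]] by simp
  have prime: "y \<in> I" if xy: "x \<in> S" "y \<in> S" "x * y \<in> I" "x \<notin> I" for x y
  proof -
    \<comment> \<open>For \<open>x\<close> outside \<open>I\<close> this ideal is strictly larger
      than \<open>I\<close>, so by maximality it contains 1; multiplying that relation by
      \<open>y\<close> puts \<open>y\<close> into \<open>I\<close>.\<close>
    let ?J = "{i + x * s | i s. i \<in> I \<and> s \<in> S}"
    have sub: "I \<subseteq> ?J"
    proof
      fix i assume "i \<in> I"
      then have "i = i + x * 0 \<and> i \<in> I \<and> 0 \<in> S" by simp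
      then show "i \<in> ?J" by blast
    qed
    have "x = 0 + x * 1" by simp
    then have "x \<in> ?J" using zero one_mem by blast
    then have "?J \<noteq> I" using xy by blast
    then have "?J \<notin> \<A>" using max sub by blast
    have J1: "?J \<subseteq> S" using I'(1) xy by auto
    have J2: "of_nat p \<in> ?J" using sub I'(2) by blast
    have J3: "u - v \<in> ?J" if uv: "u \<in> ?J" "v \<in> ?J" for u v
    proof -
      obtain i s where u: "u = i + x * s" "i \<in> I" "s \<in> S" using uv(1) by blast
      obtain j t where v: "v = j + x * t" "j \<in> I" "t \<in> S" using uv(2) by blast
      have "u - v = (i - j) + x * (s - t)" unfolding u v by (simp add: algebra_simps)
      then show ?thesis using u v I'(4) diff_mem by blast
    qed
    have J4: "u * v \<in> ?J" if uv: "u \<in> S" "v \<in> ?J" for u v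
    proof -
      obtain j t where *: "v = j + x * t" "j \<in> I" "t \<in> S" using uv(2) by blast
      then have "u * v = u * j + x * (u * t)" by (simp add: algebra_simps)
      then show ?thesis using * uv(1) I'(5) mult_mem by blast
    qed
    have "1 \<in> ?J"
    proof (rule ccontr)
      assume notin: "1 \<notin> ?J"
      have "?J \<in> \<A>"
        unfolding \<A>_def by (rule CollectI) (intro conjI ballI J1 J2 J3 J4 notin)
      with \<open>?J \<notin> \<A>\<close> show False by contradiction
    qed
    then obtain i s where "1 = i + x * s" "i \<in> I" "s \<in> S" by blast
    have "(i + x * s) * y = y * i + s * (x * y)" by (simp add: algebra_simps)
    then have "y = y * i + s * (x * y)" by (simp flip: \<open>1 = i + x * s\<close>)
    moreover have "y * i + s * (x * y) \<in> I"
      by (intro add I'(5) xy \<open>i \<in> I\<close> \<open>s \<in> S\<close>)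
    ultimately show ?thesis by simp
  qed
  have "prime_ideal_over S I p"
  proof unfold_locales
    show "x \<in> I \<or> y \<in> I" if "x \<in> S" "y \<in> S" "x * y \<in> I" for x y
      using prime[OF that] by blast
    show "x \<in> S" if "x \<in> I" for x using that I'(1) by blast
  qed (rule p I'(2-5); assumption)+
  then show ?thesis by blast
qed

text \<open>If \<open>p\<close> were a unit, its inverse would be a rational algebraic integer,
  hence an integer.\<close>

lemma ex_prime_ideal_over_int_adjoin:
  assumes "prime p" "N > 0" "z ^ N = 1"
  shows "\<exists>I. prime_ideal_over (int_adjoin z) I p"
proof (rule ex_prime_ideal_over)
  fix s assume "s \<in> int_adjoin z"
  show "of_nat p * s \<noteq> 1"
  proof
    assume ps: "of_nat p * s = 1"
    have s: "s = 1 / of_nat p" using ps assms(1)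
      by (metis mult_zero_left nonzero_mult_div_cancel_left zero_neq_one)
    have "algebraic_int s"
      using int_adjoin_root_of_unity_algebraic_int assms \<open>s \<in> int_adjoin z\<close> by blast
    moreover have "s \<in> \<rat>" unfolding s by simp
    ultimately have "s \<in> \<int>" by (rule rational_algebraic_int_is_int)
    then obtain k where "s = of_int k" by (auto elim: Ints_cases)
    with ps have "(of_int (int p * k) :: complex) = of_int 1" by simp
    then have "int p * k = 1" by (simp only: of_int_eq_iff)
    then have "int p dvd 1" by (metis dvd_triv_left)
    then show False using assms(1) by (simp add: prime_nat_iff)
  qed
qed (use assms unital_subring_int_adjoin in auto)

section \<open>Arithmetic, moments and power sums modulo the ideal\<close>

context prime_ideal_over
begin

lemma ideal_zero [simp]: "0 \<in> I"
  using ideal_diff[OF p_mem p_mem] by simp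

lemma ideal_uminus: "x \<in> I \<Longrightarrow> - x \<in> I"
  using ideal_diff[of 0 x] by simp

lemma ideal_add: "x \<in> I \<Longrightarrow> y \<in> I \<Longrightarrow> x + y \<in> I"
  using ideal_diff[of x "- y"] ideal_uminus[of y] by simp

lemma ideal_mult_right: "x \<in> I \<Longrightarrow> y \<in> S \<Longrightarrow> x * y \<in> I"
  using ideal_mult[of y x] by (simp add: mult.commute)

lemma ideal_sum: "(\<And>x. x \<in> A \<Longrightarrow> h x \<in> I) \<Longrightarrow> sum h A \<in> I"
  by (induction A rule: infinite_finite_induct) (auto intro: ideal_add)

lemma ideal_of_nat: "p dvd m \<Longrightarrow> of_nat m \<in> I"
  using ideal_mult_right[OF p_mem] by (auto elim!: dvdE)

lemma of_nat_notin_ideal: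
  assumes "\<not> p dvd m"
  shows "of_nat m \<notin> I"
proof
  assume m: "of_nat m \<in> I"
  have "coprime (int p) (int m)" using assms prime_p by (simp add: prime_imp_coprime)
  then obtain u v where "u * int p + v * int m = 1" using bezout_int[of "int p" "int m"] by auto
  then have "(1 :: 'a) = of_int (u * int p + v * int m)" by simp
  also have "\<dots> = of_int u * of_nat p + of_int v * of_nat m" by simp
  also have "\<dots> \<in> I" using m p_mem by (intro ideal_add ideal_mult) auto
  finally show False using one_notin by simp
qed

lemma ideal_power: "x \<in> S \<Longrightarrow> x ^ k \<in> I \<Longrightarrow> x \<in> I"
  by (induction k) (use one_notin prime_ideal in auto)

text \<open>For \<open>u \<noteq> 1\<close> the powers of \<open>u\<close> below \<open>n\<close>
  sum to 0, while each is 1 modulo \<open>I\<close>; this would put \<open>n\<close> into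
  \<open>I\<close>. Applied to quotients, it separates \<open>n\<close>-th roots of unity modulo
  \<open>I\<close>.\<close>

lemma root_of_unity_eq_1:
  assumes "u \<in> S" "u ^ n = 1" "u - 1 \<in> I" "\<not> p dvd n"
  shows "u = 1"
proof (rule ccontr)
  assume "u \<noteq> 1"
  have "(u - 1) * (\<Sum>i<n. u ^ i) = 0" using assms(2) by (simp add: power_diff_1_eq[symmetric])
  with \<open>u \<noteq> 1\<close> have "(\<Sum>i<n. u ^ i) = 0" by simp
  then have "of_nat n = - (\<Sum>i<n. u ^ i - 1)" by (simp add: sum_subtractf)
  also have "\<dots> \<in> I"
  proof (intro ideal_uminus ideal_sum)
    fix i
    have "u ^ i - 1 = (u - 1) * (\<Sum>j<i. u ^ j)" by (rule power_diff_1_eq)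
    also have "\<dots> \<in> I" using assms by (intro ideal_mult_right sum_mem power_mem)
    finally show "u ^ i - 1 \<in> I" .
  qed
  finally show False using of_nat_notin_ideal assms(4) by blast
qed

text \<open>Powers of \<open>x\<close> are integer combinations of binomial coefficients. The mixed
  products make the induction work: absorbing one factor \<open>x\<close> raises the lower index
  \<open>i\<close> by at most one. The case of interest is \<open>i = 0\<close>.\<close>

lemma binomial_moments_imp_power_moments:
  assumes h: "\<And>x. x \<in> A \<Longrightarrow> h x \<in> S"
    and B: "\<And>j. j < k \<Longrightarrow> (\<Sum>x\<in>A. h x * of_nat (x choose j)) \<in> I"
    and "i + j < k"
  shows "(\<Sum>x\<in>A. h x * of_nat ((x choose i) * x ^ j)) \<in> I"
  using \<open>i + j < k\<close>
proof (induction j arbitrary: i)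
  case 0
  then show ?case using B by simp
next
  case (Suc j)
  have absorb: "(x choose i) * x = Suc i * (x choose Suc i) + i * (x choose i)" for x
  proof (cases "i \<le> x")
    case True
    have "Suc i * (x choose Suc i) = (x - i) * (x choose i)"
      using binomial_absorb_comp[of x i] binomial_absorption[of i x] by simp
    with True show ?thesis by (metis add_mult_distrib le_add_diff_inverse2 mult.commute)
  qed (simp add: binomial_eq_0)
  have "(\<Sum>x\<in>A. h x * of_nat ((x choose i) * x ^ Suc j)) =
    of_nat (Suc i) * (\<Sum>x\<in>A. h x * of_nat ((x choose Suc i) * x ^ j)) +
    of_nat i * (\<Sum>x\<in>A. h x * of_nat ((x choose i) * x ^ j))"
    unfolding sum_distrib_left sum.distrib[symmetric]
  proof (rule sum.cong[OF refl])
    fix x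
    have "(x choose i) * x ^ Suc j = ((x choose i) * x) * x ^ j" by simp
    also have "\<dots> = (Suc i * (x choose Suc i) + i * (x choose i)) * x ^ j"
      by (simp only: absorb)
    finally have "(x choose i) * x ^ Suc j =
      Suc i * ((x choose Suc i) * x ^ j) + i * ((x choose i) * x ^ j)"
      by (simp only: add_mult_distrib mult.assoc)
    then have "(of_nat ((x choose i) * x ^ Suc j) :: 'a) =
      of_nat (Suc i) * of_nat ((x choose Suc i) * x ^ j) + of_nat i * of_nat ((x choose i) * x ^ j)"
      by (simp only: of_nat_add of_nat_mult)
    then show "h x * of_nat ((x choose i) * x ^ Suc j) =
      of_nat (Suc i) * (h x * of_nat ((x choose Suc i) * x ^ j)) +
      of_nat i * (h x * of_nat ((x choose i) * x ^ j))"
      by (simp only: distrib_left mult.left_commute)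
  qed
  also have "\<dots> \<in> I"
    using Suc by (intro ideal_add ideal_mult of_nat_mem Suc.IH) auto
  finally show ?case .
qed

text \<open>The binomial moments of the constant 1 are \<open>p choose Suc j\<close> by the
  hockey-stick identity, and \<open>p\<close> divides these for \<open>j < p - 1\<close>.\<close>

lemma power_sum_mem:
  assumes "0 < e" "e < p - 1"
  shows "of_nat (\<Sum>x\<in>{1..<p}. x ^ e) \<in> I"
proof -
  have p: "p > 0" using prime_p prime_gt_0_nat by blast
  have "(\<Sum>x<p. 1 * of_nat ((x choose 0) * x ^ e)) \<in> I"
  proof (rule binomial_moments_imp_power_moments[of _ _ "p - 1"])
    fix j assume "j < p - 1"
    have "(\<Sum>x<p. x choose j) = p choose Suc j"
      using sum_choose_upper[of j "p - 1"] p by (simp add: lessThan_Suc_atMost[symmetric])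
    moreover have "p dvd p choose Suc j"
      using \<open>j < p - 1\<close> prime_p by (intro dvd_choose_prime) auto
    ultimately have "of_nat (\<Sum>x<p. x choose j) \<in> I" using ideal_of_nat by simp
    then show "(\<Sum>x<p. 1 * of_nat (x choose j)) \<in> I" by simp
  qed (use assms in auto)
  then have "of_nat (\<Sum>x<p. x ^ e) \<in> I" by simp
  moreover have "(\<Sum>x<p. x ^ e) = (\<Sum>x\<in>{1..<p}. x ^ e)"
    by (rule sum.mono_neutral_right) (use assms in \<open>auto simp: power_0_left\<close>)
  ultimately show ?thesis by simp
qed

end

section \<open>Interpolation modulo a prime ideal\<close>

text \<open>Up to sign the sum is a delta kernel modulo \<open>p\<close>. For \<open>x = y\<close>
  Fermat makes each of the \<open>p - 1\<close> summands 1; otherwise multiplication by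
  \<open>x - y\<close> telescopes to a multiple of \<open>x ^ (p - 1) - y ^ (p - 1)\<close>.\<close>

lemma prime_dvd_interpolation_kernel:
  fixes p x y :: nat
  assumes p: "prime p" and xy: "x \<in> {1..<p}" "y \<in> {1..<p}"
  shows "p dvd (\<Sum>i\<in>{1..<p}. y ^ (p - 1 - i) * x ^ i) + (if x = y then 1 else 0)"
proof (cases "x = y")
  case True
  have "(\<Sum>i\<in>{1..<p}. y ^ (p - 1 - i) * x ^ i) = (\<Sum>i\<in>{1..<p}. x ^ (p - 1))"
    using True by (intro sum.cong refl) (auto simp flip: power_add)
  also have "\<dots> = (p - 1) * x ^ (p - 1)" by simp
  finally have eq: "(\<Sum>i\<in>{1..<p}. y ^ (p - 1 - i) * x ^ i) = (p - 1) * x ^ (p - 1)" .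
  have "\<not> p dvd x" using xy by (auto dest: dvd_imp_le)
  then have "[x ^ (p - 1) = 1] (mod p)" using fermat_theorem p by blast
  then have "[(p - 1) * x ^ (p - 1) + 1 = (p - 1) * 1 + 1] (mod p)"
    by (intro cong_add cong_mult cong_refl)
  moreover have "(p - 1) * 1 + 1 = p" using xy by auto
  ultimately show ?thesis unfolding eq using True by (simp add: cong_0_iff cong_def dvd_eq_mod_eq_0)
next
  case False
  obtain m where m: "p - 1 = Suc m" using xy by (cases "p - 1") auto
  then have pm: "p = Suc (Suc m)" by simp
  let ?T = "\<Sum>i<Suc m. int x ^ i * int y ^ (m - i)"
  have "(\<Sum>i\<in>{1..<p}. y ^ (p - 1 - i) * x ^ i) = (\<Sum>i<Suc m. y ^ (m - i) * x ^ Suc i)"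
    unfolding pm lessThan_atLeast0 One_nat_def sum.shift_bounds_Suc_ivl by simp
  then have eq: "int (\<Sum>i\<in>{1..<p}. y ^ (p - 1 - i) * x ^ i) = int x * ?T"
    by (simp only: of_nat_sum of_nat_mult of_nat_power power_Suc sum_distrib_left mult_ac)
  have "[int x ^ Suc m = 1] (mod int p)" if "x \<in> {1..<p}" for x
  proof -
    have "\<not> p dvd x" using that by (auto dest: dvd_imp_le)
    then have "[x ^ Suc m = 1] (mod p)" using fermat_theorem p m by metis
    then have "[int (x ^ Suc m) = int 1] (mod int p)" by (simp only: cong_int_iff)
    then show ?thesis by simp
  qed
  then have "[int x ^ Suc m = int y ^ Suc m] (mod int p)"
    using xy cong_sym cong_trans by blast
  then have "int p dvd int x ^ Suc m - int y ^ Suc m" by (simp add: cong_iff_dvd_diff)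
  then have "int p dvd (int x - int y) * ?T" by (simp only: diff_power_eq_sum)
  moreover have "\<not> int p dvd int x - int y"
  proof
    assume "int p dvd int x - int y"
    then have "[x = y] (mod p)" by (simp add: cong_iff_dvd_diff cong_int_iff[symmetric])
    then show False using False xy by (simp add: cong_def)
  qed
  ultimately have "int p dvd ?T" using p by (simp add: prime_dvd_mult_iff)
  then have "int p dvd int (\<Sum>i\<in>{1..<p}. y ^ (p - 1 - i) * x ^ i)" unfolding eq by simp
  then show ?thesis using False by (simp only: of_nat_dvd_iff if_False add_0_right)
qed

context prime_ideal_over
begin

text \<open>Summing \<open>h\<close> against the delta kernel gives a polynomial whose coefficient
  at \<open>x ^ i\<close> is minus the moment of order \<open>p - 1 - i\<close>. With exponents in
  \<open>{1..<p}\<close>, vanishing of the lowest moments kills the highest coefficients.\<close>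

lemma interpolation:
  assumes h: "\<And>x. x \<in> {1..<p} \<Longrightarrow> h x \<in> S" and x: "x \<in> {1..<p}"
  shows "h x + (\<Sum>i\<in>{1..<p}. (\<Sum>y\<in>{1..<p}. h y * of_nat (y ^ (p - 1 - i))) * of_nat (x ^ i)) \<in> I"
proof -
  let ?K = "\<lambda>y. (\<Sum>i\<in>{1..<p}. y ^ (p - 1 - i) * x ^ i) + (if x = y then 1 else 0)"
  have "h y * of_nat (?K y) = (\<Sum>i\<in>{1..<p}. h y * of_nat (y ^ (p - 1 - i)) * of_nat (x ^ i)) +
    (if x = y then h y else 0)" for y
    by (cases "x = y") (simp_all add: distrib_left sum_distrib_left mult.assoc)
  then have "(\<Sum>y\<in>{1..<p}. h y * of_nat (?K y)) =
    (\<Sum>y\<in>{1..<p}. \<Sum>i\<in>{1..<p}. h y * of_nat (y ^ (p - 1 - i)) * of_nat (x ^ i)) +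
    (\<Sum>y\<in>{1..<p}. if x = y then h y else 0)"
    by (simp only: sum.distrib)
  also have "(\<Sum>y\<in>{1..<p}. if x = y then h y else 0) = h x" using x by simp
  also have "(\<Sum>y\<in>{1..<p}. \<Sum>i\<in>{1..<p}. h y * of_nat (y ^ (p - 1 - i)) * of_nat (x ^ i)) =
    (\<Sum>i\<in>{1..<p}. (\<Sum>y\<in>{1..<p}. h y * of_nat (y ^ (p - 1 - i))) * of_nat (x ^ i))"
    by (subst sum.swap) (simp add: sum_distrib_right)
  finally have "h x + (\<Sum>i\<in>{1..<p}. (\<Sum>y\<in>{1..<p}. h y * of_nat (y ^ (p - 1 - i))) * of_nat (x ^ i)) =
    (\<Sum>y\<in>{1..<p}. h y * of_nat (?K y))" by (simp add: add.commute)
  also have "\<dots> \<in> I"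
    using h x prime_p prime_dvd_interpolation_kernel by (intro ideal_sum ideal_mult ideal_of_nat) auto
  finally show ?thesis .
qed

lemma power_sum_reduce:
  assumes "e < p - 1"
  shows "of_nat (\<Sum>x\<in>{1..<p}. x ^ (p - 1 + e)) - of_nat (\<Sum>x\<in>{1..<p}. x ^ e) \<in> I"
proof -
  have "(of_nat (\<Sum>x\<in>{1..<p}. x ^ (p - 1 + e)) :: 'a) - of_nat (\<Sum>x\<in>{1..<p}. x ^ e) =
    (\<Sum>x\<in>{1..<p}. of_nat (x ^ e * (x ^ (p - 1) - 1)))"
    unfolding of_nat_sum sum_subtractf[symmetric]
  proof (rule sum.cong[OF refl])
    fix x assume "x \<in> {1..<p}"
    then have "x ^ (p - 1) = (x ^ (p - 1) - 1) + 1" by simp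
    then have "x ^ (p - 1 + e) = x ^ e * ((x ^ (p - 1) - 1) + 1)"
      by (metis power_add mult.commute)
    then have "x ^ (p - 1 + e) = x ^ e * (x ^ (p - 1) - 1) + x ^ e"
      by (simp only: distrib_left mult_1_right)
    then have "(of_nat (x ^ (p - 1 + e)) :: 'a) = of_nat (x ^ e * (x ^ (p - 1) - 1)) + of_nat (x ^ e)"
      by (metis of_nat_add)
    then show "of_nat (x ^ (p - 1 + e)) - of_nat (x ^ e) = (of_nat (x ^ e * (x ^ (p - 1) - 1)) :: 'a)"
      by simp
  qed
  also have "\<dots> \<in> I"
  proof (intro ideal_sum ideal_of_nat dvd_mult)
    fix x assume x: "x \<in> {1..<p}"
    then have "\<not> p dvd x" by (auto dest: dvd_imp_le)
    then have "[x ^ (p - 1) = 1] (mod p)" using fermat_theorem prime_p by blast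
    then show "p dvd x ^ (p - 1) - 1" using x by (simp add: cong_altdef_nat cong_sym)
  qed
  finally show ?thesis .
qed

text \<open>By Fermat the sum is \<open>p - 1\<close> modulo \<open>p\<close>. Together with
  \<open>power_sum_mem\<close>, power sums thus detect the exponent \<open>p - 1\<close>.\<close>

lemma power_sum_notin:
  assumes "p > 2"
  shows "of_nat (\<Sum>x\<in>{1..<p}. x ^ (p - 1)) \<notin> I"
proof
  assume "of_nat (\<Sum>x\<in>{1..<p}. x ^ (p - 1)) \<in> I"
  moreover have "of_nat (\<Sum>x\<in>{1..<p}. x ^ (p - 1)) - of_nat (\<Sum>x\<in>{1..<p}. x ^ 0) \<in> I"
    using power_sum_reduce[of 0] assms by simp
  ultimately have "of_nat (\<Sum>x\<in>{1..<p}. x ^ (p - 1)) -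
     (of_nat (\<Sum>x\<in>{1..<p}. x ^ (p - 1)) - of_nat (\<Sum>x\<in>{1..<p}. x ^ 0)) \<in> I"
    by (rule ideal_diff)
  then have "of_nat (\<Sum>x\<in>{1..<p}. x ^ 0) \<in> I" by (simp only: diff_diff_eq2 add_diff_cancel_left')
  then have "of_nat (p - 1) \<in> I" by simp
  moreover have "\<not> p dvd p - 1" using assms by (auto dest: dvd_imp_le)
  ultimately show False using of_nat_notin_ideal by blast
qed

text \<open>Modulo \<open>I\<close>, \<open>f\<close> and \<open>g\<close> agree with polynomials
  \<open>F\<close> and \<open>G\<close> of degrees at most \<open>p - 1 - k\<close> and
  \<open>p - 1 - l\<close>, and \<open>F * G\<close> is 1 on the units. Playing their lowest terms
  against these degree bounds leaves a single term in \<open>F\<close>.\<close>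

lemma monomial_mod_ideal:
  assumes f: "\<And>x. x \<in> {1..<p} \<Longrightarrow> f x \<in> S" and g: "\<And>x. x \<in> {1..<p} \<Longrightarrow> g x \<in> S"
    and fg: "\<And>x. x \<in> {1..<p} \<Longrightarrow> f x * g x = 1"
    and f1: "f 1 = 1"
    and Mf: "\<And>j. j < k \<Longrightarrow> (\<Sum>x\<in>{1..<p}. f x * of_nat (x ^ j)) \<in> I"
    and Mg: "\<And>j. j < l \<Longrightarrow> (\<Sum>x\<in>{1..<p}. g x * of_nat (x ^ j)) \<in> I"
    and kl: "k \<le> p - 1" "l \<le> p - 1" "p - 1 \<le> k + l"
  shows "\<exists>d. \<forall>x\<in>{1..<p}. f x - of_nat (x ^ d) \<in> I"
proof -
  define a where "a i = - (\<Sum>y\<in>{1..<p}. f y * of_nat (y ^ (p - 1 - i)))" for i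
  define b where "b i = - (\<Sum>y\<in>{1..<p}. g y * of_nat (y ^ (p - 1 - i)))" for i
  let ?F = "\<lambda>x. \<Sum>i\<in>{1..<p}. a i * of_nat (x ^ i)" and ?G = "\<lambda>x. \<Sum>i\<in>{1..<p}. b i * of_nat (x ^ i)"
  have p2: "p \<ge> 2" using prime_p by (rule prime_ge_2_nat)
  have aS: "a i \<in> S" and bS: "b i \<in> S" for i
    unfolding a_def b_def using f g by (auto intro!: uminus_mem sum_mem mult_mem)
  have F: "f x - ?F x \<in> I" and G: "g x - ?G x \<in> I" if "x \<in> {1..<p}" for x
    using interpolation[of f x] interpolation[of g x] f g that
    by (simp_all add: a_def b_def sum_negf)
  have FS: "?F x \<in> S" and GS: "?G x \<in> S" for x
    using aS bS by (auto intro!: sum_mem mult_mem simp del: of_nat_power)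
  have ahigh: "a i \<in> I" if "p - 1 - k < i" "i < p" for i
    unfolding a_def using that by (intro ideal_uminus Mf) auto
  have bhigh: "b i \<in> I" if "p - 1 - l < i" "i < p" for i
    unfolding b_def using that by (intro ideal_uminus Mg) auto
  have ex: "\<exists>i\<in>{1..<p}. c i \<notin> I"
    if c: "\<And>i. c i \<in> S" "h 1 - (\<Sum>i\<in>{1..<p}. c i * of_nat (1 ^ i)) \<in> I" "h 1 = 1" for c h
  proof (rule ccontr)
    assume "\<not> ?thesis"
    then have "(\<Sum>i\<in>{1..<p}. c i * of_nat (1 ^ i)) \<in> I"
      by (intro ideal_sum ideal_mult_right) auto
    then have "h 1 \<in> I" using ideal_add[OF c(2)] by force
    then show False using one_notin c(3) by simp
  qed
  have 1: "1 \<in> {1..<p}" using p2 by simp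
  have g1: "g 1 = 1" using fg[OF 1] f1 by simp
  \<comment> \<open>\<open>i0\<close> and \<open>j0\<close> are the lowest exponents whose
    coefficients survive modulo \<open>I\<close>.\<close>
  define i0 where "i0 = (LEAST i. 1 \<le> i \<and> i < p \<and> a i \<notin> I)"
  define j0 where "j0 = (LEAST i. 1 \<le> i \<and> i < p \<and> b i \<notin> I)"
  have "\<exists>i. 1 \<le> i \<and> i < p \<and> a i \<notin> I"
    using ex[of a f, OF aS F[OF 1] f1] by auto
  then have i0: "1 \<le> i0" "i0 < p" "a i0 \<notin> I"
    unfolding i0_def by (metis (mono_tags, lifting) LeastI_ex)+
  have "\<exists>i. 1 \<le> i \<and> i < p \<and> b i \<notin> I"
    using ex[of b g, OF bS G[OF 1] g1] by auto
  then have j0: "1 \<le> j0" "j0 < p" "b j0 \<notin> I"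
    unfolding j0_def by (metis (mono_tags, lifting) LeastI_ex)+
  have alow: "a i \<in> I" if "1 \<le> i" "i < i0" for i
    using that not_less_Least[of i "\<lambda>i. 1 \<le> i \<and> i < p \<and> a i \<notin> I"] i0(2) unfolding i0_def[symmetric] by auto
  have blow: "b i \<in> I" if "1 \<le> i" "i < j0" for i
    using that not_less_Least[of i "\<lambda>i. 1 \<le> i \<and> i < p \<and> b i \<notin> I"] j0(2) unfolding j0_def[symmetric] by auto
  have i0k: "i0 \<le> p - 1 - k" and j0l: "j0 \<le> p - 1 - l"
    using ahigh[of i0] bhigh[of j0] i0 j0 by (meson not_le)+
  have "i0 + j0 = p - 1"
  proof (rule ccontr)
    assume "i0 + j0 \<noteq> p - 1"
    then have m: "i0 + j0 < p - 1" using i0k j0l kl by linarith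
    \<comment> \<open>Weighting \<open>F * G\<close> by \<open>x ^ r\<close> moves its lowest term
      to exponent \<open>p - 1\<close> and all other surviving terms strictly between
      \<open>p - 1\<close> and \<open>2 * (p - 1)\<close>. Summed over \<open>x\<close>, both
      \<open>x ^ r\<close> and those other terms give elements of \<open>I\<close>, so the lowest
      term would have to do so too.\<close>
    define r where "r = p - 1 - (i0 + j0)"
    have r: "0 < r" "r < p - 1" "i0 + j0 + r = p - 1" using m i0 by (auto simp: r_def)
    let ?P = "\<lambda>e. of_nat (\<Sum>x\<in>{1..<p}. x ^ e) :: 'a"
    let ?t = "\<lambda>(i, j). a i * b j * ?P (i + j + r)"
    have FG: "1 - ?F x * ?G x \<in> I" if "x \<in> {1..<p}" for x
    proof -
      have "1 - ?F x * ?G x = f x * g x - ?F x * ?G x" using fg[OF that] by simp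
      also have "\<dots> = (f x - ?F x) * g x + ?F x * (g x - ?G x)"
        by (simp only: algebra_simps)
      also have "\<dots> \<in> I"
        by (intro ideal_add ideal_mult ideal_mult_right F G FS g that)
      finally show ?thesis .
    qed
    have "(\<Sum>x\<in>{1..<p}. (1 - ?F x * ?G x) * of_nat (x ^ r)) \<in> I"
      by (intro ideal_sum ideal_mult_right FG of_nat_mem)
    also have "(\<Sum>x\<in>{1..<p}. (1 - ?F x * ?G x) * of_nat (x ^ r)) =
      ?P r - (\<Sum>x\<in>{1..<p}. ?F x * ?G x * of_nat (x ^ r))"
      by (simp add: left_diff_distrib sum_subtractf)
    also have "(\<Sum>x\<in>{1..<p}. ?F x * ?G x * of_nat (x ^ r)) =
      (\<Sum>x\<in>{1..<p}. \<Sum>i\<in>{1..<p}. \<Sum>j\<in>{1..<p}. a i * b j * of_nat (x ^ (i + j + r)))"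
      by (intro sum.cong refl, unfold sum_product, unfold sum_distrib_right, intro sum.cong refl)
        (simp add: power_add mult_ac)
    also have "\<dots> = (\<Sum>i\<in>{1..<p}. \<Sum>j\<in>{1..<p}. \<Sum>x\<in>{1..<p}. a i * b j * of_nat (x ^ (i + j + r)))"
      by (subst sum.swap, rule sum.cong[OF refl], rule sum.swap)
    also have "\<dots> = (\<Sum>i\<in>{1..<p}. \<Sum>j\<in>{1..<p}. ?t (i, j))"
      by (simp add: sum_distrib_left)
    also have "\<dots> = (\<Sum>ij\<in>{1..<p} \<times> {1..<p}. ?t ij)"
      by (simp add: sum.cartesian_product split_def)
    finally have "?P r - (\<Sum>ij\<in>{1..<p} \<times> {1..<p}. ?t ij) \<in> I" .
    then have "?P r - (?P r - (\<Sum>ij\<in>{1..<p} \<times> {1..<p}. ?t ij)) \<in> I"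
      by (rule ideal_diff[OF power_sum_mem[OF r(1,2)]])
    then have "(\<Sum>ij\<in>{1..<p} \<times> {1..<p}. ?t ij) \<in> I"
      by (simp only: diff_diff_eq2 add_diff_cancel_left')
    also have "(\<Sum>ij\<in>{1..<p} \<times> {1..<p}. ?t ij) =
      ?t (i0, j0) + (\<Sum>ij\<in>{1..<p} \<times> {1..<p} - {(i0, j0)}. ?t ij)"
      using i0 j0 by (intro sum.remove) auto
    finally have sum: "?t (i0, j0) + (\<Sum>ij\<in>{1..<p} \<times> {1..<p} - {(i0, j0)}. ?t ij) \<in> I" .
    have rest: "?t ij \<in> I" if ij: "ij \<in> {1..<p} \<times> {1..<p} - {(i0, j0)}" for ij
    proof -
      obtain i j where [simp]: "ij = (i, j)" by (cases ij)
      have ij': "1 \<le> i" "i < p" "1 \<le> j" "j < p" "(i, j) \<noteq> (i0, j0)" using ij by auto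
      show ?thesis
      proof (cases "a i \<in> I \<or> b j \<in> I")
        case True
        then have "a i * b j \<in> I" using aS bS ideal_mult ideal_mult_right by blast
        then show ?thesis by (simp add: ideal_mult_right del: of_nat_sum)
      next
        case False
        then have "i0 \<le> i" "j0 \<le> j" "i \<le> p - 1 - k" "j \<le> p - 1 - l"
          using alow blow ahigh bhigh ij' by (meson not_le)+
        then have "i0 + j0 < i + j" "i + j \<le> p - 1" using ij'(5) kl by auto
        then obtain e where e: "i + j + r = p - 1 + e" "0 < e" "e < p - 1"
          using r m i0 j0 by (intro that[of "i + j - (i0 + j0)"]) auto
        have "?P (p - 1 + e) \<in> I"
          using ideal_add[OF power_sum_reduce[OF e(3)] power_sum_mem[OF e(2,3)]]
          by (simp only: diff_add_cancel)
        then show ?thesis using e aS bS by (simp add: ideal_mult mult_mem del: of_nat_sum)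
      qed
    qed
    have "(\<Sum>ij\<in>{1..<p} \<times> {1..<p} - {(i0, j0)}. ?t ij) \<in> I"
      using rest by (rule ideal_sum)
    from ideal_diff[OF sum this] have "?t (i0, j0) \<in> I" by (simp only: add_diff_cancel_right')
    then have "a i0 * b j0 * ?P (p - 1) \<in> I" using r by simp
    then have "a i0 \<in> I \<or> b j0 \<in> I \<or> ?P (p - 1) \<in> I"
      using prime_ideal[OF mult_mem[OF aS bS] of_nat_mem] prime_ideal[OF aS bS] by metis
    moreover have "p > 2" using r by linarith
    ultimately show False using i0(3) j0(3) power_sum_notin by simp
  qed
  \<comment> \<open>The lowest exponent now equals the degree bound, so only one term is
    left.\<close>
  then have i0_eq: "i0 = p - 1 - k" using i0k j0l kl by linarith
  have mono: "?F x - a i0 * of_nat (x ^ i0) \<in> I" for x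
  proof -
    have "?F x - a i0 * of_nat (x ^ i0) = (\<Sum>i\<in>{1..<p} - {i0}. a i * of_nat (x ^ i))"
      using i0 by (subst sum.remove[of _ i0]) auto
    also have "\<dots> \<in> I"
    proof (intro ideal_sum ideal_mult_right of_nat_mem)
      fix i assume "i \<in> {1..<p} - {i0}"
      then show "a i \<in> I" using alow[of i] ahigh[of i] i0_eq by force
    qed
    finally show ?thesis .
  qed
  have fx: "f x - a i0 * of_nat (x ^ i0) \<in> I" if "x \<in> {1..<p}" for x
    using ideal_add[OF F[OF that] mono[of x]] by simp
  \<comment> \<open>The normalization \<open>f 1 = 1\<close> makes the remaining coefficient 1
    modulo \<open>I\<close>.\<close>
  have "1 - a i0 \<in> I" using fx[OF 1] f1 by simp
  have "f x - of_nat (x ^ i0) \<in> I" if "x \<in> {1..<p}" for x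
  proof -
    have "(f x - a i0 * of_nat (x ^ i0)) - (1 - a i0) * of_nat (x ^ i0) \<in> I"
      by (intro ideal_diff ideal_mult_right fx that \<open>1 - a i0 \<in> I\<close> of_nat_mem)
    then show ?thesis by (simp add: algebra_simps)
  qed
  then show ?thesis by blast
qed

end

section \<open>Divisibility in the localization\<close>

context prime_ideal_over
begin

text \<open>Expand \<open>(1 + (z - 1))\<^bsup>p\<^esup> = 1\<close> and divide by \<open>z - 1\<close>.\<close>

lemma cyclotomic_uniformizer:
  assumes z: "z \<in> S" "z ^ p = 1" "z \<noteq> 1"
  shows "z - 1 \<in> I" "\<exists>v\<in>S - I. of_nat p * v = (z - 1) ^ (p - 1)"
proof -
  let ?q = "z - 1"
  have p2: "p \<ge> 2" using prime_p by (rule prime_ge_2_nat)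
  obtain m where m: "p = Suc (Suc m)" using p2 by (metis add_2_eq_Suc le_Suc_ex)
  have qS: "?q \<in> S" using z(1) by auto
  \<comment> \<open>As \<open>p = m + 2\<close>, \<open>t\<close> collects the terms of degree 2 to
    \<open>p - 1\<close>, divided by \<open>p * (z - 1) ^ 2\<close>.\<close>
  define t where "t = (\<Sum>k<m. of_nat ((p choose Suc (Suc k)) div p) * ?q ^ k)"
  have tS: "t \<in> S" unfolding t_def using qS by (intro sum_mem mult_mem of_nat_mem power_mem)
  have "1 = (?q + 1) ^ p" using z(2) by simp
  also have "\<dots> = (\<Sum>k\<le>p. of_nat (p choose k) * ?q ^ k)"
    using binomial_ring[of ?q 1 p] by simp
  also have "\<dots> = 1 + of_nat p * ?q + (\<Sum>k<m. of_nat (p choose Suc (Suc k)) * ?q ^ Suc (Suc k)) + ?q ^ p"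
    unfolding m lessThan_Suc_atMost[symmetric]
    by (subst sum.lessThan_Suc, subst sum.lessThan_Suc_shift, subst sum.lessThan_Suc_shift)
      (simp del: binomial_Suc_Suc power_Suc add: add.assoc)
  also have "(\<Sum>k<m. of_nat (p choose Suc (Suc k)) * ?q ^ Suc (Suc k)) = of_nat p * ?q * ?q * t"
    unfolding t_def sum_distrib_left
  proof (rule sum.cong[OF refl])
    fix k assume "k \<in> {..<m}"
    then have "p dvd p choose Suc (Suc k)"
      using prime_p m by (intro dvd_choose_prime) auto
    then have "p choose Suc (Suc k) = p * ((p choose Suc (Suc k)) div p)" by simp
    then have "of_nat (p choose Suc (Suc k)) = (of_nat p * of_nat ((p choose Suc (Suc k)) div p) :: 'a)"
      by (metis of_nat_mult)
    then show "of_nat (p choose Suc (Suc k)) * ?q ^ Suc (Suc k) =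
      of_nat p * ?q * ?q * (of_nat ((p choose Suc (Suc k)) div p) * ?q ^ k)"
      by (simp only: power_Suc mult_ac)
  qed
  also have "?q ^ p = ?q * ?q ^ (p - 1)" unfolding m by simp
  finally have "?q * (of_nat p * (1 + ?q * t) + ?q ^ (p - 1)) = 0"
    by (simp add: algebra_simps)
  then have "of_nat p * (1 + ?q * t) + ?q ^ (p - 1) = 0" using z(3) by simp
  then have eq: "of_nat p * (- (1 + ?q * t)) = ?q ^ (p - 1)"
    unfolding mult_minus_right by (rule minus_unique)
  have "of_nat p * (- (1 + ?q * t)) \<in> I"
    using p_mem qS tS by (intro ideal_mult_right uminus_mem add_mem mult_mem one_mem)
  then show qI: "?q \<in> I" using ideal_power[OF qS] unfolding eq by blast
  \<comment> \<open>The cofactor is -1 modulo \<open>I\<close>, hence a unit in the localization: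
    there \<open>p\<close> and \<open>(z - 1) ^ (p - 1)\<close> are associates.\<close>
  have "- (1 + ?q * t) \<notin> I"
  proof
    assume "- (1 + ?q * t) \<in> I"
    from ideal_uminus[OF ideal_add[OF this ideal_mult_right[OF qI tS]]]
    show False using one_notin by simp
  qed
  then show "\<exists>v\<in>S - I. of_nat p * v = ?q ^ (p - 1)"
    using qS tS by (intro bexI[where P = "\<lambda>v. of_nat p * v = ?q ^ (p - 1)", OF eq] DiffI uminus_mem add_mem mult_mem one_mem)
qed

text \<open>\<open>z\<close> is divisible by \<open>q\<^bsup>m\<^esup>\<close> in the localization of \<open>S\<close> at \<open>I\<close>.\<close>

definition local_dvd :: "'a \<Rightarrow> nat \<Rightarrow> 'a \<Rightarrow> bool" where
  "local_dvd q m z \<longleftrightarrow> (\<exists>s\<in>S - I. \<exists>y\<in>S. s * z = q ^ m * y)"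

lemma mult_mem_Diff: "s \<in> S - I \<Longrightarrow> t \<in> S - I \<Longrightarrow> s * t \<in> S - I"
  using prime_ideal by auto

lemma one_mem_Diff: "1 \<in> S - I"
  using one_notin by simp

lemma local_dvd_power_mult: "y \<in> S \<Longrightarrow> local_dvd q m (q ^ m * y)"
  unfolding local_dvd_def using one_mem_Diff by (metis mult_1)

lemma local_dvd_zero: "local_dvd q m 0"
  using local_dvd_power_mult[of 0 q m] by simp

lemma local_dvd_add:
  assumes "local_dvd q m z" "local_dvd q m w"
  shows "local_dvd q m (z + w)"
proof -
  obtain s y t u where *: "s \<in> S - I" "y \<in> S" "s * z = q ^ m * y" "t \<in> S - I" "u \<in> S" "t * w = q ^ m * u"
    using assms unfolding local_dvd_def by blast
  have "(s * t) * (z + w) = t * (s * z) + s * (t * w)" by (simp add: algebra_simps)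
  also have "\<dots> = q ^ m * (t * y + s * u)" unfolding *(3,6) by (simp add: algebra_simps)
  finally show ?thesis
    unfolding local_dvd_def using * mult_mem_Diff[OF *(1,4)] by (meson DiffD1 add_mem mult_mem)
qed

lemma local_dvd_mult:
  assumes "local_dvd q m z" "local_dvd q l w"
  shows "local_dvd q (m + l) (z * w)"
proof -
  obtain s y t u where *: "s \<in> S - I" "y \<in> S" "s * z = q ^ m * y" "t \<in> S - I" "u \<in> S" "t * w = q ^ l * u"
    using assms unfolding local_dvd_def by blast
  have "(s * t) * (z * w) = (s * z) * (t * w)" by (simp add: mult_ac)
  also have "\<dots> = q ^ (m + l) * (y * u)" unfolding *(3,6) by (simp add: power_add mult_ac)
  finally show ?thesis
    unfolding local_dvd_def using * mult_mem_Diff[OF *(1,4)] by (meson mult_mem)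
qed

lemma local_dvd_of_mem: "z \<in> S \<Longrightarrow> local_dvd q 0 z"
  using local_dvd_power_mult[of z q 0] by simp

lemma local_dvd_mult_left: "y \<in> S \<Longrightarrow> local_dvd q m z \<Longrightarrow> local_dvd q m (y * z)"
  using local_dvd_mult[of q 0 y m z] local_dvd_of_mem by simp

lemma local_dvd_uminus: "local_dvd q m z \<Longrightarrow> local_dvd q m (- z)"
  using local_dvd_mult_left[of "- 1" q m z] by (simp add: uminus_mem)

lemma local_dvd_diff: "local_dvd q m z \<Longrightarrow> local_dvd q m w \<Longrightarrow> local_dvd q m (z - w)"
  using local_dvd_add[of q m z "- w"] local_dvd_uminus by simp

lemma local_dvd_sum: "(\<And>x. x \<in> A \<Longrightarrow> local_dvd q m (h x)) \<Longrightarrow> local_dvd q m (sum h A)"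
  by (induction A rule: infinite_finite_induct) (auto intro: local_dvd_add local_dvd_zero)

lemma local_dvd_le:
  assumes "q \<in> S" "m \<le> l" "local_dvd q l z"
  shows "local_dvd q m z"
proof -
  obtain s y where *: "s \<in> S - I" "y \<in> S" "s * z = q ^ l * y"
    using assms unfolding local_dvd_def by blast
  have "q ^ l * y = q ^ m * (q ^ (l - m) * y)"
    using assms(2) by (simp add: power_add[symmetric] mult.assoc[symmetric])
  then show ?thesis unfolding local_dvd_def using * assms(1) by (metis mult_mem power_mem)
qed

text \<open>After cancelling \<open>q ^ k\<close>, a relation \<open>s * b = q * y\<close> would put
  \<open>s * b\<close> into the prime ideal \<open>I\<close>, although neither factor lies in
  it.\<close>

lemma not_local_dvd:
  assumes "q \<in> I" "q \<noteq> 0" "b \<in> S - I"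
  shows "\<not> local_dvd q (Suc k) (q ^ k * b)"
proof
  assume "local_dvd q (Suc k) (q ^ k * b)"
  then have "\<exists>s\<in>S - I. \<exists>y\<in>S. s * (q ^ k * b) = q ^ Suc k * y"
    by (simp only: local_dvd_def)
  then obtain s y where s: "s \<in> S - I" and y: "y \<in> S" and eq: "s * (q ^ k * b) = q ^ Suc k * y"
    by (elim bexE)
  have "q ^ k * (s * b) = s * (q ^ k * b)" by (rule mult.left_commute)
  also have "\<dots> = q ^ k * (q * y)" unfolding eq by (simp only: power_Suc2 mult.assoc)
  finally have "s * b = q * y" using assms(2) by simp
  then have "s * b \<in> I" using ideal_mult_right[OF assms(1) y] by simp
  then show False using mult_mem_Diff[OF s assms(3)] by simp
qed

text \<open>An element that is congruent to its own \<open>Q\<close>-th power modulo \<open>p\<close> generates an idempotent ideal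
  of \<open>S / p S\<close>, so that it is locally a multiple of \<open>p\<close> as soon as it lies in \<open>I\<close>.\<close>

lemma local_dvd_of_power_eq_self:
  assumes q: "v \<in> S - I" "of_nat p * v = q ^ (p - 1)"
    and x: "x \<in> I" "c \<in> S" "x ^ Q = x + of_nat p * c" "Q > 1"
  shows "local_dvd q (p - 1) x"
proof -
  obtain r where r: "Q = Suc (Suc r)" using x(4) by (intro that[of "Q - 2"]) simp
  have xS: "x \<in> S" using x(1) by (rule ideal_subset)
  have "x ^ Suc r \<in> I" using ideal_mult_right[OF x(1) power_mem[OF xS]] by simp
  \<comment> \<open>This makes \<open>x ^ (Q - 1) - 1\<close> a unit of the localization; its
    product with \<open>x\<close> is \<open>p * c\<close>, and \<open>v\<close> turns
    \<open>p\<close> into \<open>q ^ (p - 1)\<close>.\<close>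
  then have "x ^ Suc r - 1 \<notin> I" using ideal_diff[of "x ^ Suc r" "x ^ Suc r - 1"] one_notin by auto
  then have s: "v * (x ^ Suc r - 1) \<in> S - I"
    using xS by (intro mult_mem_Diff q DiffI diff_mem power_mem one_mem)
  have "v * (x ^ Suc r - 1) * x = v * (x ^ Q - x)" unfolding r by (simp add: algebra_simps)
  also have "\<dots> = (of_nat p * v) * c" unfolding x(3) by simp
  finally have "v * (x ^ Suc r - 1) * x = q ^ (p - 1) * c" unfolding q(2) .
  then show ?thesis unfolding local_dvd_def using s x(2) by blast
qed

text \<open>Modulo \<open>q ^ Suc k\<close> only the term at \<open>k\<close> can survive: later
  terms carry enough factors \<open>q\<close>, earlier ones are divisible by assumption.\<close>

lemma local_expansion:
  assumes q: "q \<in> S" and b: "\<And>j. b j \<in> S" and "k < p"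
    and low: "\<And>j. j < k \<Longrightarrow> local_dvd q (Suc k) (b j)"
  shows "local_dvd q (Suc k) ((\<Sum>j<p. q ^ j * b j) - q ^ k * b k)"
proof -
  have "(\<Sum>j<p. q ^ j * b j) - q ^ k * b k = (\<Sum>j\<in>{..<p} - {k}. q ^ j * b j)"
    using \<open>k < p\<close> by (subst sum.remove[of _ k]) auto
  also have "local_dvd q (Suc k) \<dots>"
  proof (rule local_dvd_sum)
    fix j assume "j \<in> {..<p} - {k}"
    then consider "j < k" | "Suc k \<le> j" by force
    then show "local_dvd q (Suc k) (q ^ j * b j)"
    proof cases
      case 1
      then show ?thesis using low q by (intro local_dvd_mult_left power_mem)
    next
      case 2
      then show ?thesis using local_dvd_le[OF q] local_dvd_power_mult b by blast
    qed
  qed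
  finally show ?thesis .
qed

text \<open>Let \<open>k\<close> and \<open>l\<close> be the first indices where \<open>b\<close>
  and \<open>c\<close> leave \<open>I\<close>. If \<open>k + l < p - 1\<close>, the product of the
  two sums has order exactly \<open>k + l\<close> at \<open>q\<close>, but \<open>p\<close> has
  order at least \<open>p - 1\<close>.\<close>

lemma vanishing_moments:
  assumes q: "q \<in> I" "q \<noteq> 0" "v \<in> S - I" "of_nat p * v = q ^ (p - 1)"
    and b: "\<And>j. b j \<in> S" and c: "\<And>j. c j \<in> S"
    and bI: "\<And>j. b j \<in> I \<Longrightarrow> local_dvd q (p - 1) (b j)"
    and cI: "\<And>j. c j \<in> I \<Longrightarrow> local_dvd q (p - 1) (c j)"
    and prod: "(\<Sum>j<p. q ^ j * b j) * (\<Sum>j<p. q ^ j * c j) = of_nat p"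
  shows "\<exists>k\<le>p - 1. \<exists>l\<le>p - 1. p - 1 \<le> k + l \<and> (\<forall>j<k. b j \<in> I) \<and> (\<forall>j<l. c j \<in> I)"
proof -
  have qS: "q \<in> S" using q(1) by (rule ideal_subset)
  \<comment> \<open>The index is capped at \<open>p - 1\<close>; if the cap is reached, nothing is
    claimed about the value there.\<close>
  have first: "\<exists>k\<le>p - 1. (\<forall>j<k. h j \<in> I) \<and> (k < p - 1 \<longrightarrow> h k \<notin> I)" for h :: "nat \<Rightarrow> 'a"
  proof (cases "\<forall>j<p - 1. h j \<in> I")
    case False
    then obtain k where "k < p - 1 \<and> h k \<notin> I" "\<And>i. i < k \<Longrightarrow> \<not> (i < p - 1 \<and> h i \<notin> I)"
      using exists_least_iff[of "\<lambda>k. k < p - 1 \<and> h k \<notin> I"] by auto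
    then show ?thesis by (intro exI[of _ k]) auto
  qed blast
  obtain k where k: "k \<le> p - 1" "\<forall>j<k. b j \<in> I" "k < p - 1 \<Longrightarrow> b k \<notin> I" using first[of b] by blast
  obtain l where l: "l \<le> p - 1" "\<forall>j<l. c j \<in> I" "l < p - 1 \<Longrightarrow> c l \<notin> I" using first[of c] by blast
  have "p - 1 \<le> k + l"
  proof (rule ccontr)
    assume "\<not> p - 1 \<le> k + l"
    then have kl: "k + l < p - 1" by simp
    let ?F = "\<Sum>j<p. q ^ j * b j" and ?G = "\<Sum>j<p. q ^ j * c j"
    have F: "local_dvd q (Suc k) (?F - q ^ k * b k)"
    proof (rule local_expansion[OF qS b])
      show "local_dvd q (Suc k) (b j)" if "j < k" for j
        by (rule local_dvd_le[OF qS _ bI]) (use that kl k(2) in auto)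
    qed (use kl in simp)
    have G: "local_dvd q (Suc l) (?G - q ^ l * c l)"
    proof (rule local_expansion[OF qS c])
      show "local_dvd q (Suc l) (c j)" if "j < l" for j
        by (rule local_dvd_le[OF qS _ cI]) (use that kl l(2) in auto)
    qed (use kl in simp)
    have GS: "local_dvd q l ?G"
      using local_dvd_add[OF local_dvd_le[OF qS _ G, of l] local_dvd_power_mult[OF c, of q l l]] by simp
    \<comment> \<open>The leading terms are substituted one factor at a time; both errors have order
      at least \<open>Suc (k + l)\<close>.\<close>
    have "local_dvd q (Suc (k + l)) ((?F - q ^ k * b k) * ?G)"
      using local_dvd_mult[OF F GS] by simp
    moreover have "local_dvd q (Suc (k + l)) (q ^ k * b k * (?G - q ^ l * c l))"
      using local_dvd_mult[OF local_dvd_power_mult[OF b, of q k k] G] by simp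
    ultimately have "local_dvd q (Suc (k + l)) ((?F - q ^ k * b k) * ?G + q ^ k * b k * (?G - q ^ l * c l))"
      by (rule local_dvd_add)
    also have "(?F - q ^ k * b k) * ?G + q ^ k * b k * (?G - q ^ l * c l) =
      of_nat p - q ^ (k + l) * (b k * c l)"
      unfolding prod[symmetric] by (simp only: algebra_simps power_add)
    finally have 1: "local_dvd q (Suc (k + l)) (of_nat p - q ^ (k + l) * (b k * c l))" .
    have "v * of_nat p = q ^ (p - 1) * 1" using q(4) by (simp add: mult.commute)
    then have "local_dvd q (p - 1) (of_nat p)" unfolding local_dvd_def using q(3) one_mem by blast
    then have "local_dvd q (Suc (k + l)) (of_nat p)"
      by (rule local_dvd_le[OF qS, rotated]) (use kl in simp)
    from local_dvd_diff[OF this 1] have "local_dvd q (Suc (k + l)) (q ^ (k + l) * (b k * c l))" by simp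
    moreover have "b k * c l \<in> S - I" using k l kl b c by (intro mult_mem_Diff) auto
    ultimately show False using not_local_dvd q by blast
  qed
  then show ?thesis using k l by blast
qed

end

section \<open>Gauss sums\<close>

lemma (in prime_ideal_over) ideal_power_diff:
  assumes "a \<in> S" "b \<in> S" "a - b \<in> I"
  shows "a ^ j - b ^ j \<in> I"
proof (induction j)
  case (Suc j)
  have "a ^ Suc j - b ^ Suc j = a * (a ^ j - b ^ j) + (a - b) * b ^ j"
    by (simp add: algebra_simps)
  also have "\<dots> \<in> I"
    using assms Suc by (intro ideal_add ideal_mult ideal_mult_right power_mem)
  finally show ?case .
qed simp

lemma root_of_unity_mult_cnj:
  assumes "n > 0" "w ^ n = (1 :: complex)"
  shows "w * cnj w = 1"
  using power_eq_1_iff[OF assms(2)] assms(1) complex_norm_square[of w] by simp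

text \<open>Expand \<open>z = 1 + (z - 1)\<close>; the range \<open>j < p\<close> serves all
  \<open>x\<close> at once because \<open>x choose j\<close> vanishes for
  \<open>j > x\<close>.\<close>

lemma sum_binomial_expansion:
  fixes h :: "nat \<Rightarrow> 'a::comm_ring_1"
  assumes "A \<subseteq> {..<p}"
  shows "(\<Sum>x\<in>A. h x * z ^ x) = (\<Sum>j<p. (z - 1) ^ j * (\<Sum>x\<in>A. h x * of_nat (x choose j)))"
proof -
  have "z ^ x = (\<Sum>j<p. of_nat (x choose j) * (z - 1) ^ j)" if "x \<in> A" for x
  proof -
    have "z ^ x = (\<Sum>j\<le>x. of_nat (x choose j) * (z - 1) ^ j)"
      using binomial_ring[of "z - 1" 1 x] by simp
    also have "\<dots> = (\<Sum>j<p. of_nat (x choose j) * (z - 1) ^ j)"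
      using that assms by (intro sum.mono_neutral_left) (auto simp: binomial_eq_0)
    finally show ?thesis .
  qed
  then have "(\<Sum>x\<in>A. h x * z ^ x) = (\<Sum>x\<in>A. \<Sum>j<p. h x * (of_nat (x choose j) * (z - 1) ^ j))"
    by (simp add: sum_distrib_left)
  also have "\<dots> = (\<Sum>j<p. \<Sum>x\<in>A. h x * (of_nat (x choose j) * (z - 1) ^ j))"
    by (rule sum.swap)
  finally show ?thesis by (simp add: sum_distrib_left mult_ac)
qed

lemma sum_reflect:
  fixes h :: "nat \<Rightarrow> 'a::comm_monoid_add"
  shows "(\<Sum>x\<in>{1..<p}. h (p - x)) = (\<Sum>x\<in>{1..<p}. h x)"
  by (rule sum.reindex_bij_witness[of _ "\<lambda>x. p - x" "\<lambda>x. p - x"]) auto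

lemma root_of_unity_power_minus:
  fixes z :: complex
  assumes "z ^ p = 1" "x \<le> p" "p > 0"
  shows "z ^ (p - x) = cnj (z ^ x)"
proof -
  have "(z ^ x) ^ p = 1" using assms by (metis power_mult mult.commute power_one)
  then have "z ^ x * cnj (z ^ x) = 1" by (rule root_of_unity_mult_cnj[OF assms(3)])
  moreover have "z ^ (p - x) * z ^ x = 1" using assms by (simp flip: power_add)
  ultimately show ?thesis by (metis mult.assoc mult.right_neutral mult_1)
qed

text \<open>The conjugate of \<open>z ^ x\<close> is \<open>z ^ (p - x)\<close>. Reflecting the
  index gives a sum over powers of the same \<open>z\<close>, which can again be expanded in
  \<open>z - 1\<close>.\<close>

lemma cnj_gauss_sum:
  fixes z :: complex
  assumes "z ^ p = 1"
  shows "cnj (\<Sum>x\<in>{1..<p}. f x * z ^ x) = (\<Sum>x\<in>{1..<p}. cnj (f (p - x)) * z ^ x)"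
proof -
  have "cnj (\<Sum>x\<in>{1..<p}. f x * z ^ x) = (\<Sum>x\<in>{1..<p}. cnj (f x) * z ^ (p - x))"
    unfolding cnj_sum using assms
    by (intro sum.cong refl) (simp add: root_of_unity_power_minus)
  also have "\<dots> = (\<Sum>x\<in>{1..<p}. cnj (f (p - x)) * z ^ (p - (p - x)))"
    by (rule sum_reflect[symmetric])
  finally show ?thesis by simp
qed

lemma multiplicative_if_norm_gauss_sum:
  fixes f :: "nat \<Rightarrow> complex"
  assumes p: "prime p" and n: "n > 0" "\<not> p dvd n"
    and fn: "\<And>x. x \<in> {1..<p} \<Longrightarrow> f x ^ n = 1" and f1: "f 1 = 1"
    and z: "z ^ p = 1" "z \<noteq> 1"
    and G: "cmod (\<Sum>x\<in>{1..<p}. f x * z ^ x) = sqrt (real p)"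
    and xy: "x \<in> {1..<p}" "y \<in> {1..<p}"
  shows "f (x * y mod p) = f x * f y"
proof -
  \<comment> \<open>Two rings are used: \<open>int_adjoin w\<close>, where \<open>p\<close> is
    unramified, contains the values of \<open>f\<close> and their moments;
    \<open>int_adjoin \<theta>\<close> also contains \<open>z\<close>.\<close>
  define w where "w = cis (2 * pi / real n)"
  define \<theta> where "\<theta> = cis (2 * pi / real (n * p))"
  let ?R = "int_adjoin w" and ?S = "int_adjoin \<theta>"
  have p0: "p > 0" using p prime_gt_0_nat by blast
  have np: "n * p > 0" using n p0 by simp
  have wn: "w ^ n = 1" and tN: "\<theta> ^ (n * p) = 1"
    using n np by (simp_all add: w_def \<theta>_def DeMoivre)
  obtain I where "prime_ideal_over ?S I p"
    using ex_prime_ideal_over_int_adjoin[OF p np tN] by blast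
  then interpret prime_ideal_over ?S I p .
  interpret R: unital_subring ?R by (rule unital_subring_int_adjoin)
  have rootS: "u \<in> ?S" if "u ^ (n * p) = 1" for u
    using root_of_unity_mem_int_adjoin[OF np that] by (simp add: \<theta>_def)
  have rootR: "u \<in> ?R" if "u ^ n = 1" for u
    using root_of_unity_mem_int_adjoin[OF n(1) that] by (simp add: w_def)
  have RS: "?R \<subseteq> ?S"
    using wn by (intro int_adjoin_subset unital_subring_axioms rootS) (simp add: power_mult)
  have zS: "z \<in> ?S" using z(1) by (intro rootS) (simp add: power_mult mult.commute[of n])
  obtain v where v: "v \<in> ?S - I" "of_nat p * v = (z - 1) ^ (p - 1)"
    and qI: "z - 1 \<in> I" using cyclotomic_uniformizer[OF zS z] by blast
  define g where "g x = cnj (f x)" for x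
  have gn: "g x ^ n = 1" if "x \<in> {1..<p}" for x
    using fn[OF that] unfolding g_def by (metis complex_cnj_one complex_cnj_power)
  have fR: "f x \<in> ?R" and gR: "g x \<in> ?R" if "x \<in> {1..<p}" for x
    using that by (auto intro!: rootR fn gn)
  have fg: "f x * g x = 1" if "x \<in> {1..<p}" for x
    unfolding g_def using fn[OF that] n by (intro root_of_unity_mult_cnj)
  define b where "b h j = (\<Sum>x\<in>{1..<p}. h x * of_nat (x choose j))" for h :: "nat \<Rightarrow> complex" and j
  have bR: "b h j \<in> ?R" if "\<And>x. x \<in> {1..<p} \<Longrightarrow> h x \<in> ?R" for h j
    unfolding b_def using that by (intro R.sum_mem R.mult_mem R.of_nat_mem)
  have Q: "p ^ totient n > 1"
    using n p prime_gt_1_nat by (intro one_less_power) auto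
  have bI: "local_dvd (z - 1) (p - 1) (b h j)"
    if h: "\<And>x. x \<in> {1..<p} \<Longrightarrow> h x \<in> ?R" "b h j \<in> I" for h j
  proof -
    have "coprime p n" using p n by (simp add: prime_imp_coprime)
    moreover have "b h j \<in> ?R" by (intro bR h(1))
    ultimately obtain c where c: "c \<in> ?R" "b h j ^ (p ^ totient n) = b h j + of_nat p * c"
      using int_adjoin_power_eq_self[OF p _ wn] by blast
    show ?thesis
      by (rule local_dvd_of_power_eq_self[OF v h(2) subsetD[OF RS c(1)] c(2) Q])
  qed
  let ?g = "\<lambda>x. g (p - x)"
  have g'R: "?g x \<in> ?R" if "x \<in> {1..<p}" for x using gR that by auto
  have expand: "(\<Sum>x\<in>{1..<p}. h x * z ^ x) = (\<Sum>j<p. (z - 1) ^ j * b h j)" for h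
    unfolding b_def by (rule sum_binomial_expansion) auto
  have "(\<Sum>x\<in>{1..<p}. f x * z ^ x) * cnj (\<Sum>x\<in>{1..<p}. f x * z ^ x) = of_nat p"
    unfolding complex_norm_square[symmetric] G by simp
  moreover have "cnj (\<Sum>x\<in>{1..<p}. f x * z ^ x) = (\<Sum>j<p. (z - 1) ^ j * b ?g j)"
    unfolding expand[symmetric] g_def by (rule cnj_gauss_sum[OF z(1)])
  ultimately have prod: "(\<Sum>j<p. (z - 1) ^ j * b f j) * (\<Sum>j<p. (z - 1) ^ j * b ?g j) = of_nat p"
    by (simp only: expand[of f])
  have "\<exists>k\<le>p - 1. \<exists>l\<le>p - 1. p - 1 \<le> k + l \<and> (\<forall>j<k. b f j \<in> I) \<and> (\<forall>j<l. b ?g j \<in> I)"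
  proof (rule vanishing_moments[OF qI _ v _ _ _ _ prod])
    show "b f j \<in> ?S" "b ?g j \<in> ?S" for j using bR[of f j] bR[of ?g j] fR g'R RS by blast+
    show "local_dvd (z - 1) (p - 1) (b f j)" if "b f j \<in> I" for j by (rule bI[OF fR that])
    show "local_dvd (z - 1) (p - 1) (b ?g j)" if "b ?g j \<in> I" for j by (rule bI[OF g'R that])
  qed (use z(2) in simp)
  then obtain k l where kl: "k \<le> p - 1" "l \<le> p - 1" "p - 1 \<le> k + l"
    and bf: "\<And>j. j < k \<Longrightarrow> b f j \<in> I" and bg: "\<And>j. j < l \<Longrightarrow> b ?g j \<in> I"
    by auto
  have Mf: "(\<Sum>x\<in>{1..<p}. f x * of_nat (x ^ j)) \<in> I" if "j < k" for j
    using binomial_moments_imp_power_moments[of "{1..<p}" f k 0 j] that fR RS bf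
    unfolding b_def by auto
  \<comment> \<open>The moments at hand are those of the reflected function. Since
    \<open>p - x\<close> is \<open>- x\<close> modulo \<open>I\<close>, they differ from those of
    \<open>g\<close> by the sign \<open>(- 1) ^ j\<close>.\<close>
  have Mg: "(\<Sum>x\<in>{1..<p}. g x * of_nat (x ^ j)) \<in> I" if "j < l" for j
  proof -
    have 1: "(\<Sum>x\<in>{1..<p}. ?g x * of_nat (x ^ j)) \<in> I"
      using binomial_moments_imp_power_moments[of "{1..<p}" ?g l 0 j] that g'R RS bg
      unfolding b_def by auto
    have "(\<Sum>x\<in>{1..<p}. ?g x * of_nat (x ^ j)) = (\<Sum>x\<in>{1..<p}. ?g (p - x) * of_nat ((p - x) ^ j))"
      by (rule sum_reflect[symmetric])
    also have "\<dots> = (\<Sum>x\<in>{1..<p}. g x * of_nat (p - x) ^ j)" by simp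
    finally have 2: "(\<Sum>x\<in>{1..<p}. g x * of_nat (p - x) ^ j) \<in> I" using 1 by simp
    have 3: "(\<Sum>x\<in>{1..<p}. g x * (of_nat (p - x) ^ j - (- of_nat x) ^ j)) \<in> I"
    proof (intro ideal_sum ideal_mult ideal_power_diff)
      fix x assume x: "x \<in> {1..<p}"
      then show "g x \<in> ?S" using gR RS by blast
      show "of_nat (p - x) - - of_nat x \<in> I" using x p_mem by (simp add: of_nat_diff)
    qed auto
    have "(\<Sum>x\<in>{1..<p}. g x * (- of_nat x) ^ j) \<in> I"
      using ideal_diff[OF 2 3] by (simp add: right_diff_distrib sum_subtractf)
    then have "(- 1) ^ j * (\<Sum>x\<in>{1..<p}. g x * (- of_nat x) ^ j) \<in> I"
      by (intro ideal_mult power_mem uminus_mem one_mem)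
    also have "(- 1) ^ j * (\<Sum>x\<in>{1..<p}. g x * (- of_nat x) ^ j) = (\<Sum>x\<in>{1..<p}. g x * of_nat (x ^ j))"
      unfolding sum_distrib_left
    proof (rule sum.cong[OF refl])
      fix x
      have "(- 1) ^ j * (- of_nat x) ^ j = (of_nat x ^ j :: complex)"
        by (simp flip: power_mult_distrib)
      then show "(- 1) ^ j * (g x * (- of_nat x) ^ j) = g x * of_nat (x ^ j)"
        by (simp add: mult.left_commute)
    qed
    finally show ?thesis .
  qed
  obtain d where d: "\<And>x. x \<in> {1..<p} \<Longrightarrow> f x - of_nat (x ^ d) \<in> I"
    using monomial_mod_ideal[OF _ _ fg f1 Mf Mg kl] fR gR RS by blast
  define m where "m = x * y mod p"
  have "\<not> p dvd x * y" using p xy by (auto simp: prime_dvd_mult_iff dest: dvd_imp_le)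
  then have m: "m \<in> {1..<p}" using p0 by (auto simp: m_def dvd_eq_mod_eq_0 Suc_le_eq)
  have "(of_nat (x * y) :: complex) = of_nat (p * (x * y div p) + m)" by (simp add: m_def)
  then have "(of_nat m - of_nat (x * y) :: complex) = - (of_nat p * of_nat (x * y div p))"
    by (simp only: of_nat_add of_nat_mult) simp
  also have "\<dots> \<in> I" using p_mem by (intro ideal_uminus ideal_mult_right of_nat_mem)
  finally have e1: "of_nat m ^ d - of_nat (x * y) ^ d \<in> I" by (intro ideal_power_diff) auto
  have e2: "f x * (f y - of_nat (y ^ d)) + (f x - of_nat (x ^ d)) * of_nat (y ^ d) \<in> I"
    using d xy fR RS by (intro ideal_add ideal_mult ideal_mult_right) auto
  \<comment> \<open>This chains the congruences from \<open>f m\<close> through \<open>m ^ d\<close>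
    and \<open>(x * y) ^ d\<close> to \<open>f x * f y\<close>.\<close>
  have "(f m - of_nat (m ^ d)) + (of_nat m ^ d - of_nat (x * y) ^ d)
    - (f x * (f y - of_nat (y ^ d)) + (f x - of_nat (x ^ d)) * of_nat (y ^ d)) \<in> I"
    by (rule ideal_diff[OF ideal_add[OF d[OF m] e1] e2])
  also have "(f m - of_nat (m ^ d)) + (of_nat m ^ d - of_nat (x * y) ^ d)
    - (f x * (f y - of_nat (y ^ d)) + (f x - of_nat (x ^ d)) * of_nat (y ^ d)) = f m - f x * f y"
    by (simp add: algebra_simps)
  finally have diff: "f m - f x * f y \<in> I" .
  have inv: "f x * f y * (g x * g y) = 1"
    using fg[OF xy(1)] fg[OF xy(2)] by (metis mult.assoc mult.left_commute mult_1_right)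
  \<comment> \<open>The quotient of \<open>f m\<close> by \<open>f x * f y\<close> is an
    \<open>n\<close>-th root of unity congruent to 1, hence equal to 1.\<close>
  define u where "u = f m * (g x * g y)"
  have uS: "g x * g y \<in> ?S" "u \<in> ?S"
    unfolding u_def by (intro mult_mem subsetD[OF RS] fR gR m xy)+
  have "u - 1 = (f m - f x * f y) * (g x * g y)" using inv by (simp add: u_def algebra_simps)
  also have "\<dots> \<in> I" using diff uS by (intro ideal_mult_right)
  finally have "u = 1"
    using n uS m xy by (intro root_of_unity_eq_1[of u n]) (auto simp: u_def power_mult_distrib fn gn)
  then have "f m = f x * f y" using inv
    unfolding u_def by (metis mult.assoc mult.commute mult_1_right)
  then show ?thesis by (simp add: m_def)
qed

section \<open>The Gauss sum of a nontrivial character\<close>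

lemma sum_roots_of_unity_except_0:
  fixes w :: complex
  assumes "w ^ p = 1" "p > 0"
  shows "(\<Sum>y\<in>{1..<p}. w ^ y) = (if w = 1 then of_nat p else 0) - 1"
proof -
  have "(w - 1) * (\<Sum>y<p. w ^ y) = 0" using assms(1) by (simp flip: power_diff_1_eq)
  then have "(\<Sum>y<p. w ^ y) = (if w = 1 then of_nat p else 0)" by auto
  moreover have "{..<p} = insert 0 {1..<p}" using assms(2) by auto
  ultimately have "1 + (\<Sum>y\<in>{1..<p}. w ^ y) = (if w = 1 then of_nat p else 0)" by simp
  then show ?thesis by (simp only: eq_diff_eq add.commute)
qed

lemma bij_betw_mult_mod_prime:
  fixes p y :: nat
  assumes "prime p" "y \<in> {1..<p}"
  shows "bij_betw (\<lambda>t. t * y mod p) {1..<p} {1..<p}"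
proof -
  have "\<not> p dvd y" using assms(2) by (auto dest: dvd_imp_le)
  then have "coprime y p" using assms(1) prime_imp_coprime coprime_commute by blast
  have "inj_on (\<lambda>t. t * y mod p) {1..<p}"
  proof (rule inj_onI)
    fix s t assume st: "s \<in> {1..<p}" "t \<in> {1..<p}" "s * y mod p = t * y mod p"
    then have "[s = t] (mod p)"
      using cong_mult_rcancel_nat[OF \<open>coprime y p\<close>] by (simp add: cong_def)
    then show "s = t" using st by (simp add: cong_def)
  qed
  moreover have "(\<lambda>t. t * y mod p) ` {1..<p} \<subseteq> {1..<p}"
  proof clarify
    fix t assume "t \<in> {1..<p}"
    then have "\<not> p dvd t * y" using assms by (auto simp: prime_dvd_mult_iff dest: dvd_imp_le)
    then show "t * y mod p \<in> {1..<p}" using assms(2) by (auto simp: dvd_eq_mod_eq_0 Suc_le_eq)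
  qed
  ultimately show ?thesis unfolding bij_betw_def by (simp add: endo_inj_surj)
qed

lemma power_mod_root_of_unity:
  fixes z :: "'a::monoid_mult"
  assumes "z ^ p = 1"
  shows "z ^ (m mod p) = z ^ m"
proof -
  have "z ^ m = z ^ (p * (m div p) + m mod p)" by simp
  also have "\<dots> = z ^ (m mod p)" by (simp only: power_add power_mult assms power_one mult_1_left)
  finally show ?thesis by simp
qed

text \<open>In the double sum for the squared norm, substituting \<open>t * y\<close> for
  \<open>x\<close> frees the inner sum over \<open>y\<close> from \<open>f\<close>; it is
  \<open>p - 1\<close> for \<open>t = 1\<close> and \<open>- 1\<close> otherwise, and the sum of
  \<open>f\<close> vanishes.\<close>

lemma norm_gauss_sum_character:
  fixes f :: "nat \<Rightarrow> complex"
  assumes p: "prime p"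
    and unit: "\<And>x. x \<in> {1..<p} \<Longrightarrow> f x * cnj (f x) = 1" and f1: "f 1 = 1"
    and mult: "\<And>x y. x \<in> {1..<p} \<Longrightarrow> y \<in> {1..<p} \<Longrightarrow> f (x * y mod p) = f x * f y"
    and nontriv: "a \<in> {1..<p}" "f a \<noteq> 1"
    and z: "z ^ p = 1" "z \<noteq> 1"
  shows "cmod (\<Sum>x\<in>{1..<p}. f x * z ^ x) = sqrt (real p)"
proof -
  let ?A = "{1..<p}" and ?G = "\<Sum>x\<in>{1..<p}. f x * z ^ x"
  have p0: "p > 0" using p prime_gt_0_nat by blast
  \<comment> \<open>Multiplication by \<open>a\<close> permutes the units, so the factor
    \<open>f a \<noteq> 1\<close> leaves the sum of \<open>f\<close> unchanged and the sum is
    0.\<close>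
  have "(\<Sum>t\<in>?A. f t) = (\<Sum>t\<in>?A. f (t * a mod p))"
    by (rule sum.reindex_bij_betw[OF bij_betw_mult_mod_prime[OF p nontriv(1)], symmetric])
  also have "\<dots> = (\<Sum>t\<in>?A. f t) * f a"
    unfolding sum_distrib_right using mult nontriv(1) by (intro sum.cong) auto
  finally have "(\<Sum>t\<in>?A. f t) * (f a - 1) = 0" by (simp add: algebra_simps)
  then have sum0: "(\<Sum>t\<in>?A. f t) = 0" using nontriv(2) by simp
  have zz: "z * cnj z = 1" using root_of_unity_mult_cnj p0 z(1) by blast
  have w: "(z ^ t * cnj z) ^ p = 1" for t
    using z(1) by (simp add: power_mult_distrib flip: power_mult complex_cnj_power)
      (simp add: mult.commute[of t] power_mult)
  have w1: "z ^ t * cnj z = 1 \<longleftrightarrow> t = 1" if "t \<in> ?A" for t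
  proof
    assume "z ^ t * cnj z = 1"
    then have "z ^ t = z" using zz by (metis mult.assoc mult.commute mult_1_right)
    moreover have "z ^ t = z ^ (t - 1) * z" using that by (cases t) auto
    moreover have "z \<noteq> 0" using zz by auto
    ultimately have z1: "z ^ (t - 1) = 1" by simp
    show "t = 1"
    proof (rule ccontr)
      assume "t \<noteq> 1"
      then have "\<not> p dvd t - 1" using that by (auto dest: dvd_imp_le)
      \<comment> \<open>Raising \<open>z ^ (t - 1) = 1\<close> to the inverse of
        \<open>t - 1\<close> modulo \<open>p\<close> would give \<open>z = 1\<close>.\<close>
      then have "coprime (t - 1) p" using p prime_imp_coprime coprime_commute by blast
      then obtain s where "[(t - 1) * s = 1] (mod p)" using cong_solve_coprime_nat by auto
      then have "z ^ ((t - 1) * s) = z ^ 1"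
        using power_mod_root_of_unity[OF z(1)] by (metis cong_def)
      then show False using z1 z(2) by (simp add: power_mult)
    qed
  qed (use zz in simp)
  have "?G * cnj ?G = (\<Sum>y\<in>?A. \<Sum>x\<in>?A. f x * z ^ x * cnj (f y * z ^ y))"
    unfolding cnj_sum sum_product by (rule sum.swap)
  also have "\<dots> = (\<Sum>y\<in>?A. \<Sum>t\<in>?A. f (t * y mod p) * z ^ (t * y mod p) * cnj (f y * z ^ y))"
    using bij_betw_mult_mod_prime[OF p]
    by (intro sum.cong refl sum.reindex_bij_betw[symmetric]) auto
  also have "\<dots> = (\<Sum>y\<in>?A. \<Sum>t\<in>?A. f t * (z ^ t * cnj z) ^ y)"
  proof (intro sum.cong refl)
    fix y t assume yt: "y \<in> ?A" "t \<in> ?A"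
    have "f (t * y mod p) * z ^ (t * y mod p) * cnj (f y * z ^ y) =
      (f t * f y) * z ^ (t * y) * (cnj (f y) * cnj (z ^ y))"
      using mult[OF yt(2,1)] power_mod_root_of_unity[OF z(1)] by simp
    also have "\<dots> = f t * (f y * cnj (f y)) * (z ^ (t * y) * cnj z ^ y)" by simp
    finally show "f (t * y mod p) * z ^ (t * y mod p) * cnj (f y * z ^ y) = f t * (z ^ t * cnj z) ^ y"
      using unit[OF yt(1)] by (simp add: power_mult power_mult_distrib)
  qed
  also have "\<dots> = (\<Sum>t\<in>?A. f t * (\<Sum>y\<in>?A. (z ^ t * cnj z) ^ y))"
    unfolding sum_distrib_left by (rule sum.swap)
  also have "\<dots> = (\<Sum>t\<in>?A. (if t = 1 then f t * of_nat p else 0) - f t)"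
  proof (intro sum.cong refl)
    fix t assume t: "t \<in> ?A"
    show "f t * (\<Sum>y\<in>?A. (z ^ t * cnj z) ^ y) = (if t = 1 then f t * of_nat p else 0) - f t"
      unfolding sum_roots_of_unity_except_0[OF w p0] w1[OF t] by (simp add: right_diff_distrib)
  qed
  also have "\<dots> = (\<Sum>t\<in>?A. if t = 1 then f t * of_nat p else 0)"
    unfolding sum_subtractf sum0 by simp
  also have "\<dots> = of_nat p" using f1 prime_gt_1_nat[OF p] by (simp add: sum.delta)
  finally have "of_real ((cmod ?G)\<^sup>2) = (of_real (real p) :: complex)"
    unfolding complex_norm_square by simp
  then have "(cmod ?G)\<^sup>2 = real p" by (simp only: of_real_eq_iff)
  then show ?thesis by (metis norm_ge_zero real_sqrt_unique)
qed

section \<open>From the Fourier transform to Gauss sums\<close>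

lemma carrier_Fp_units: "prime p \<Longrightarrow> carrier (Fp_units p) = {1..int p - 1}"
  using residues_prime.res_prime_units_eq[of p] prime_gt_0_nat[of p]
  by (simp add: residues_prime_def units_of_carrier of_nat_diff Suc_leI)

lemma additive_exp_of_nat_mult: "additive_exp (real k * r) = additive_exp r ^ k"
  unfolding additive_exp_def by (simp add: exp_of_nat_mult[symmetric] mult_ac)

lemma additive_exp_eq_1_iff: "additive_exp r = 1 \<longleftrightarrow> r \<in> \<int>"
proof -
  have cis: "additive_exp r = cis (2 * pi * r)"
    by (simp add: additive_exp_def cis_conv_exp mult_ac)
  show ?thesis
  proof
    assume "additive_exp r = 1"
    then have "cos (2 * pi * r) = 1" unfolding cis by (metis cis.sel(1) one_complex.sel(1))
    then obtain k :: int where "2 * pi * r = of_int k * 2 * pi"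
      unfolding cos_one_2pi_int by blast
    then have "r = of_int k" by simp
    then show "r \<in> \<int>" by simp
  qed (simp add: cis cis_multiple_2pi)
qed

lemma fourier_eq_gauss_sum:
  assumes "prime p"
  shows "fourier p f a = 1 / of_real (sqrt (real p)) *
    (\<Sum>x\<in>{1..<p}. f (int x) * additive_exp (- real_of_int a / real p) ^ x)"
proof -
  let ?e = "\<lambda>x. additive_exp (- (real_of_int x * real_of_int a) / real p)"
  have "carrier (residue_ring (int p)) = {0..int p - 1}" by (simp add: residue_ring_def)
  then have "(\<Sum>x\<in>carrier (residue_ring (int p)). extend_by_zero p f x * ?e x) =
    (\<Sum>x\<in>{1..int p - 1}. f x * ?e x)"
    using carrier_Fp_units[OF assms]
    by (intro sum.mono_neutral_cong_right) (auto simp: extend_by_zero_def)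
  also have "\<dots> = (\<Sum>x\<in>{1..<p}. f (int x) * ?e (int x))"
    by (rule sum.reindex_bij_witness[of _ int nat]) auto
  also have "\<dots> = (\<Sum>x\<in>{1..<p}. f (int x) * additive_exp (- real_of_int a / real p) ^ x)"
    by (simp flip: additive_exp_of_nat_mult)
  finally show ?thesis unfolding fourier_def by simp
qed

lemma norm_fourier_eq_1_iff:
  assumes "prime p"
  shows "cmod (fourier p f a) = 1 \<longleftrightarrow>
    cmod (\<Sum>x\<in>{1..<p}. f (int x) * additive_exp (- real_of_int a / real p) ^ x) = sqrt (real p)"
  unfolding fourier_eq_gauss_sum[OF assms] norm_mult
  using prime_gt_0_nat[OF assms] by (auto simp: norm_divide field_simps)

lemma additive_exp_primitive_root:
  assumes "prime p" "a \<in> {1..int p - 1}"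
  shows "additive_exp (- real_of_int a / real p) ^ p = 1" "additive_exp (- real_of_int a / real p) \<noteq> 1"
proof -
  have p0: "p > 0" using assms(1) prime_gt_0_nat by blast
  show "additive_exp (- real_of_int a / real p) ^ p = 1"
    using p0 unfolding additive_exp_of_nat_mult[symmetric] additive_exp_eq_1_iff by simp
  show "additive_exp (- real_of_int a / real p) \<noteq> 1"
  proof
    assume "additive_exp (- real_of_int a / real p) = 1"
    then obtain k where "- real_of_int a / real p = of_int k"
      unfolding additive_exp_eq_1_iff by (elim Ints_cases)
    then have "real_of_int (- a) = real_of_int (k * int p)" using p0 by (simp add: field_simps)
    then have "- a = k * int p" by (simp only: of_int_eq_iff)
    then have "int p dvd a" by (metis dvd_minus_iff dvd_triv_right)
    then show False using assms(2) by (auto dest: zdvd_imp_le)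
  qed
qed

text \<open>The values of \<open>f\<close> are nonzero by assumption, so being a homomorphism
  amounts to the product rule, here on natural representatives.\<close>

lemma mult_character_iff:
  assumes p: "prime p" and f: "f \<in> carrier (Fp_units p) \<rightarrow> carrier complex_units"
  shows "mult_character p f \<longleftrightarrow>
    (\<forall>x\<in>{1..<p}. \<forall>y\<in>{1..<p}. f (int (x * y mod p)) = f (int x) * f (int y))"
proof -
  have "mult_character p f \<longleftrightarrow>
    (\<forall>x\<in>{1..int p - 1}. \<forall>y\<in>{1..int p - 1}. f (x * y mod int p) = f x * f y)"
    using f carrier_Fp_units[OF p]
    by (simp add: mult_character_def hom_def complex_units_def units_of_mult residue_ring_def)
  moreover have "{1..int p - 1} = int ` {1..<p}"
    using image_int_atLeastLessThan[of 1 p] by auto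
  ultimately show ?thesis by (simp add: zmod_int)
qed

theorem theorem1p2:
  fixes p n :: nat and f :: "int \<Rightarrow> complex"
  assumes "prime p"
    and "n > 0"
    and "\<not> p dvd n"
    and "f \<in> carrier (Fp_units p) \<rightarrow> carrier complex_units"
    and "\<And>x. x \<in> carrier (Fp_units p) \<Longrightarrow> f x ^ n = 1"
    and "f \<one>\<^bsub>Fp_units p\<^esub> = 1"
  shows "nontrivial_mult_character p f \<longleftrightarrow>
    (\<exists>a \<in> carrier (Fp_units p). cmod (fourier p f a) = 1)"
proof -
  let ?f = "\<lambda>x. f (int x)" and ?z = "\<lambda>a. additive_exp (- real_of_int a / real p)"
  note carrier = carrier_Fp_units[OF assms(1)]
  note root = additive_exp_primitive_root[OF assms(1)]
  have p1: "p > 1" using assms(1) by (rule prime_gt_1_nat)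
  have fn: "?f x ^ n = 1" if "x \<in> {1..<p}" for x
    using assms(5)[of "int x"] that by (simp add: carrier)
  have f1: "?f 1 = 1" using assms(6) by (simp add: units_of_one residue_ring_def)
  show ?thesis
  proof
    assume char: "nontrivial_mult_character p f"
    then obtain t where t: "t \<in> {1..int p - 1}" "f t \<noteq> 1"
      by (auto simp: nontrivial_mult_character_def carrier)
    have 1: "1 \<in> {1..int p - 1}" using p1 by simp
    \<comment> \<open>The frequency 1 serves as witness.\<close>
    have "cmod (\<Sum>x\<in>{1..<p}. ?f x * ?z 1 ^ x) = sqrt (real p)"
    proof (rule norm_gauss_sum_character[of p ?f "nat t"])
      show "?f x * cnj (?f x) = 1" if "x \<in> {1..<p}" for x
        using root_of_unity_mult_cnj[OF assms(2) fn[OF that]] .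
      show "?f (x * y mod p) = ?f x * ?f y" if "x \<in> {1..<p}" "y \<in> {1..<p}" for x y
        using char mult_character_iff[OF assms(1,4)] that
        unfolding nontrivial_mult_character_def by blast
    qed (use assms(1) f1 t root[OF 1] in auto)
    then show "\<exists>a\<in>carrier (Fp_units p). cmod (fourier p f a) = 1"
      using 1 norm_fourier_eq_1_iff[OF assms(1)] carrier by blast
  next
    assume "\<exists>a\<in>carrier (Fp_units p). cmod (fourier p f a) = 1"
    then obtain a where a: "a \<in> {1..int p - 1}"
      and G: "cmod (\<Sum>x\<in>{1..<p}. ?f x * ?z a ^ x) = sqrt (real p)"
      using norm_fourier_eq_1_iff[OF assms(1)] carrier by blast
    have "mult_character p f"
      unfolding mult_character_iff[OF assms(1,4)]
      using multiplicative_if_norm_gauss_sum[OF assms(1-3) fn f1 root[OF a] G] by blast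
    moreover have "\<not> (\<forall>x\<in>carrier (Fp_units p). f x = 1)"
    proof
      assume "\<forall>x\<in>carrier (Fp_units p). f x = 1"
      \<comment> \<open>For trivial \<open>f\<close> the Gauss sum is \<open>- 1\<close>, of modulus
        1 instead of \<open>sqrt p\<close>.\<close>
      then have "(\<Sum>x\<in>{1..<p}. ?f x * ?z a ^ x) = (\<Sum>x\<in>{1..<p}. ?z a ^ x)"
        by (intro sum.cong) (auto simp: carrier)
      also have "\<dots> = - 1"
        using sum_roots_of_unity_except_0[OF root(1)[OF a]] root(2)[OF a] p1 by simp
      finally have "sqrt (real p) = 1" using G by simp
      then show False using p1 by simp
    qed
    ultimately show "nontrivial_mult_character p f"
      by (simp add: nontrivial_mult_character_def)
  qed
qed

end
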